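(* Assume the generator hypothesis: for every $\theta\in\Theta$, $Q_\theta=(q_{ij}(\theta))_{1\le i,j\le N}$ is a real $N\times N$ matrix with $q_{ij}(\theta)\ge 0$ for $i\ne j$ and $q_{ii}(\theta)=-\sum_{j\ne i}q_{ij}(\theta)$, and there exists $L_Q>0$ with $$\|Q_\theta^*-Q_{\bar\theta}^*\|_{1\to1}\le L_Q|\theta-\bar\theta|\qquad\text{for all }\theta,\bar\theta\in\Theta .$$ Then for each $\delta>0$ the system $$\dot\theta=G(\theta,w,\mu),\qquad \dot w=b(\theta,\mu)-A(\theta,\mu)w,\qquad \delta\dot\mu=Q_\theta^*\mu$$ generates a continuous semiflow $S_\delta(t)$, $t\ge 0$, on $X=\Theta\times\mathbb{R}^m\times\Delta_S$. The set $$K:=\Theta\times\overline{B_{R_w}(0)}\times\Delta_S$$ is compact, forward invariant, and absorbing for $S_\delta(t)$. Consequently, $S_\delta(t)$ possesses a unique compact global attractor $\mathcal{A}_\delta=\omega(K)$.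
   Context: Fix integers $N,K_0,d,m\ge1$ (number of states, number of actions, actor dimension, critic dimension), state set $S=\{1,\dots,N\}$, and positive constants $R_\theta,\tau,\lambda_c$. Below, $i$ ranges over $\{1,\dots,N\}$ and $a,b$ over $\{1,\dots,K_0\}$ when used as action indices. Fix data $r_{i,a}\in\mathbb{R}$, $\psi_{i,a}\in\mathbb{R}^d$, $\varphi_{i,a}\in\mathbb{R}^m$. Let $$\Theta=[-R_\theta,R_\theta]^d,\qquad \Delta_S=\Bigl\{\mu\in[0,\infty)^N:\sum_i\mu_i=1\Bigr\}.$$ Here $R_\theta$ is a constant (the subscript is part of its name). Define $$\pi_\theta(a\mid i)=\frac{\exp(\psi_{i,a}\cdot\theta/\tau)}{\sum_{b=1}^{K_0}\exp(\psi_{i,b}\cdot\theta/\tau)},\qquad \nu_{\theta,\mu}(i,a)=\mu_i\,\pi_\theta(a\mid i),$$ $$b(\theta,\mu)=\sum_{i,a}\nu_{\theta,\mu}(i,a)\,r_{i,a}\,\varphi_{i,a}\in\mathbb{R}^m,\qquad A(\theta,\mu)=\lambda_c I_m+\sum_{i,a}\nu_{\theta,\mu}(i,a)\,\varphi_{i,a}\varphi_{i,a}^\top,$$ $$\widetilde G(\theta,w,\mu)=\sum_{i,a}\nu_{\theta,\mu}(i,a)\bigl(r_{i,a}+\varphi_{i,a}\cdot w-\tau\log\pi_\theta(a\mid i)\bigr)\nabla_\theta\log\pi_\theta(a\mid i)\in\mathbb{R}^d,$$ $$D(\theta)=\operatorname{diag}(R_\theta^2-\theta_1^2,\dots,R_\theta^2-\theta_d^2),\qquad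 G(\theta,w,\mu)=D(\theta)\widetilde G(\theta,w,\mu).$$ $Q_\theta^*$ is the transpose of $Q_\theta$, acting on column vectors of $\mathbb{R}^N$; $|\cdot|_1$ is the $\ell^1$-norm on $\mathbb{R}^N$ and $\|\cdot\|_{1\to1}$ the induced operator norm. $|\cdot|$ is the Euclidean norm on $\mathbb{R}^d$ and $\mathbb{R}^m$. $X$ carries the metric $d_X((\theta,w,\mu),(\bar\theta,\bar w,\bar\mu))=|\theta-\bar\theta|+|w-\bar w|+|\mu-\bar\mu|_1$. Constants: $M_r=\max_{i,a}|r_{i,a}|$, $M_\varphi=\max_{i,a}|\varphi_{i,a}|$, $B_b=M_rM_\varphi$, $R_w=\max\{1,2B_b/\lambda_c\}$; $\overline{B_{R_w}(0)}$ is the closed Euclidean ball of radius $R_w$ in $\mathbb{R}^m$. Terminology. The system generates a continuous semiflow on $X$ if for each $x_0\in X$ there is a unique $X$-valued solution on $[0,\infty)$ starting at $x_0$, and, writing $S_\delta(t)x_0$ for its value at time $t$, one has $S_\delta(0)=\mathrm{Id}$, $S_\delta(t+s)=S_\delta(t)S_\delta(s)$, and $(t,x)\mapsto S_\delta(t)x$ is continuous. $K$ is forward invariant if $S_\delta(t)K\subset K$ for all $t\ge0$; it is absorbing if for every bounded $B\subset X$ there is $T_B\ge0$ with $S_\delta(t)B\subset K$ for all $t\ge T_B$. A compact global attractor is a nonempty compact set $\mathcal{A}\subset X$ with $S_\delta(t)\mathcal{A}=\mathcal{A}$ for all $t\ge0$ and $\sup_{x\in B}\inf_{y\in\mathcal{A}}d_X(S_\delta(t)x,y)\to0$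 as $t\to\infty$ for every bounded $B\subset X$. $\omega(K)=\bigcap_{s\ge0}\overline{\bigcup_{t\ge s}S_\delta(t)K}$. *)

theory Defs
  imports "HOL-Analysis.Analysis"
begin

section \<open>Norms, gradients and the phase space\<close>

definition l1_norm :: "real^'n::finite \<Rightarrow> real" where
  "l1_norm x = (\<Sum>i\<in>UNIV. \<bar>x $ i\<bar>)"

text \<open>The \<open>l1\<close> analogue of the library's \<open>onorm\<close>; \<open>x = 0\<close> contributes \<open>0 / 0 = 0\<close>.\<close>
definition l1_onorm :: "real^'n::finite^'n \<Rightarrow> real" where
  "l1_onorm M = (SUP x. l1_norm (M *v x) / l1_norm x)"

text \<open>Meaningful only where \<open>f\<close> is differentiable.\<close>
definition gradient :: "('a::real_inner \<Rightarrow> real) \<Rightarrow> 'a \<Rightarrow> 'a" where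
  "gradient f x = (THE D. GDERIV f x :> D)"

definition Theta :: "real \<Rightarrow> (real^'d::finite) set" where
  "Theta R = {theta. \<forall>j. - R \<le> theta $ j \<and> theta $ j \<le> R}"

definition prob_simplex :: "(real^'n::finite) set" where
  "prob_simplex = {mu. (\<forall>i. 0 \<le> mu $ i) \<and> (\<Sum>i\<in>UNIV. mu $ i) = 1}"

definition phase_space :: "real \<Rightarrow> ((real^'d::finite) \<times> (real^'m::finite) \<times> (real^'n::finite)) set" where
  "phase_space R = Theta R \<times> UNIV \<times> prob_simplex"

definition dX :: "(real^'d::finite) \<times> (real^'m::finite) \<times> (real^'n::finite) \<Rightarrow>
    (real^'d) \<times> (real^'m) \<times> (real^'n) \<Rightarrow> real" where
  "dX = (\<lambda>(theta, w, mu) (theta', w', mu').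
     norm (theta - theta') + norm (w - w') + l1_norm (mu - mu'))"

lemma Metric_space_dX: "Metric_space M dX"
proof
  have l1_nonneg: "0 \<le> l1_norm x" for x :: "real^'n"
    by (simp add: l1_norm_def sum_nonneg)
  have l1_0: "l1_norm x = 0 \<longleftrightarrow> x = 0" for x :: "real^'n"
    by (simp add: l1_norm_def sum_nonneg_eq_0_iff vec_eq_iff)
  have l1_minus: "l1_norm (x - y) = l1_norm (y - x)" for x y :: "real^'n"
    by (simp add: l1_norm_def abs_minus_commute)
  have l1_triangle: "l1_norm (x - z) \<le> l1_norm (x - y) + l1_norm (y - z)" for x y z :: "real^'n"
    unfolding l1_norm_def sum.distrib[symmetric] by (rule sum_mono) simp
  fix x y z :: "(real^'d) \<times> (real^'m) \<times> (real^'n)"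
  show "0 \<le> dX x y"
    by (simp add: dX_def l1_nonneg split: prod.splits)
  show "dX x y = dX y x"
    by (simp add: dX_def l1_minus norm_minus_commute split: prod.splits)
  show "dX x y = 0 \<longleftrightarrow> x = y"
    using l1_nonneg[of "snd (snd x) - snd (snd y)"]
    by (auto simp: dX_def l1_0 add_nonneg_eq_0_iff split: prod.splits)
  show "dX x z \<le> dX x y + dX y z"
  proof -
    obtain a b c where x: "x = (a, b, c)" by (cases x)
    obtain a' b' c' where y: "y = (a', b', c')" by (cases y)
    obtain a'' b'' c'' where z: "z = (a'', b'', c'')" by (cases z)
    show ?thesis
      using l1_triangle[of c c'' c'] norm_triangle_ineq[of "a - a'" "a' - a''"]
        norm_triangle_ineq[of "b - b'" "b' - b''"]
      by (simp add: dX_def x y z)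
  qed
qed

section \<open>The actor-critic system\<close>

text \<open>Throughout, \<open>'n\<close> indexes states and \<open>'k\<close> actions; \<open>lam\<close> is the constant $\lambda_c$.\<close>

definition policy :: "('n \<Rightarrow> 'k::finite \<Rightarrow> real^'d::finite) \<Rightarrow> real \<Rightarrow> real^'d \<Rightarrow> 'n \<Rightarrow> 'k \<Rightarrow> real" where
  "policy psi tau theta i a =
     exp ((psi i a \<bullet> theta) / tau) / (\<Sum>b\<in>UNIV. exp ((psi i b \<bullet> theta) / tau))"

definition nu :: "('n::finite \<Rightarrow> 'k::finite \<Rightarrow> real^'d::finite) \<Rightarrow> real \<Rightarrow>
    real^'d \<Rightarrow> real^'n \<Rightarrow> 'n \<Rightarrow> 'k \<Rightarrow> real" where
  "nu psi tau theta mu i a = mu $ i * policy psi tau theta i a"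

definition b_vec :: "('n::finite \<Rightarrow> 'k::finite \<Rightarrow> real) \<Rightarrow> ('n \<Rightarrow> 'k \<Rightarrow> real^'d::finite) \<Rightarrow>
    ('n \<Rightarrow> 'k \<Rightarrow> real^'m::finite) \<Rightarrow> real \<Rightarrow> real^'d \<Rightarrow> real^'n \<Rightarrow> real^'m" where
  "b_vec r psi phi tau theta mu =
     (\<Sum>i\<in>UNIV. \<Sum>a\<in>UNIV. (nu psi tau theta mu i a * r i a) *\<^sub>R phi i a)"

definition outer :: "real^'m::finite \<Rightarrow> real^'m^'m" where
  "outer v = (\<chi> p q. v $ p * v $ q)"

definition A_mat :: "('n::finite \<Rightarrow> 'k::finite \<Rightarrow> real^'d::finite) \<Rightarrow>
    ('n \<Rightarrow> 'k \<Rightarrow> real^'m::finite) \<Rightarrow> real \<Rightarrow> real \<Rightarrow> real^'d \<Rightarrow> real^'n \<Rightarrow> real^'m^'m" where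
  "A_mat psi phi tau lam theta mu =
     lam *\<^sub>R mat 1 + (\<Sum>i\<in>UNIV. \<Sum>a\<in>UNIV. nu psi tau theta mu i a *\<^sub>R outer (phi i a))"

definition G_tilde :: "('n::finite \<Rightarrow> 'k::finite \<Rightarrow> real) \<Rightarrow> ('n \<Rightarrow> 'k \<Rightarrow> real^'d::finite) \<Rightarrow>
    ('n \<Rightarrow> 'k \<Rightarrow> real^'m::finite) \<Rightarrow> real \<Rightarrow> real^'d \<Rightarrow> real^'m \<Rightarrow> real^'n \<Rightarrow> real^'d" where
  "G_tilde r psi phi tau theta w mu =
     (\<Sum>i\<in>UNIV. \<Sum>a\<in>UNIV.
        (nu psi tau theta mu i a
          * (r i a + phi i a \<bullet> w - tau * ln (policy psi tau theta i a)))
        *\<^sub>R gradient (\<lambda>theta'. ln (policy psi tau theta' i a)) theta)"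

definition D_mat :: "real \<Rightarrow> real^'d::finite \<Rightarrow> real^'d^'d" where
  "D_mat R theta = (\<chi> j l. if j = l then R\<^sup>2 - (theta $ j)\<^sup>2 else 0)"

definition G_vec :: "('n::finite \<Rightarrow> 'k::finite \<Rightarrow> real) \<Rightarrow> ('n \<Rightarrow> 'k \<Rightarrow> real^'d::finite) \<Rightarrow>
    ('n \<Rightarrow> 'k \<Rightarrow> real^'m::finite) \<Rightarrow> real \<Rightarrow> real \<Rightarrow> real^'d \<Rightarrow> real^'m \<Rightarrow> real^'n \<Rightarrow> real^'d" where
  "G_vec r psi phi R tau theta w mu = D_mat R theta *v G_tilde r psi phi tau theta w mu"

definition vector_field :: "('n::finite \<Rightarrow> 'k::finite \<Rightarrow> real) \<Rightarrow> ('n \<Rightarrow> 'k \<Rightarrow> real^'d::finite) \<Rightarrow>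
    ('n \<Rightarrow> 'k \<Rightarrow> real^'m::finite) \<Rightarrow> real \<Rightarrow> real \<Rightarrow> real \<Rightarrow> (real^'d \<Rightarrow> real^'n^'n) \<Rightarrow> real \<Rightarrow>
    (real^'d) \<times> (real^'m) \<times> (real^'n) \<Rightarrow> (real^'d) \<times> (real^'m) \<times> (real^'n)" where
  "vector_field r psi phi R tau lam Q delta = (\<lambda>(theta, w, mu).
     (G_vec r psi phi R tau theta w mu,
      b_vec r psi phi tau theta mu - A_mat psi phi tau lam theta mu *v w,
      (1 / delta) *\<^sub>R (transpose (Q theta) *v mu)))"

definition M_r :: "('n::finite \<Rightarrow> 'k::finite \<Rightarrow> real) \<Rightarrow> real" where
  "M_r r = Max (range (\<lambda>(i, a). \<bar>r i a\<bar>))"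

definition M_phi :: "('n::finite \<Rightarrow> 'k::finite \<Rightarrow> real^'m::finite) \<Rightarrow> real" where
  "M_phi phi = Max (range (\<lambda>(i, a). norm (phi i a)))"

definition B_b :: "('n::finite \<Rightarrow> 'k::finite \<Rightarrow> real) \<Rightarrow> ('n \<Rightarrow> 'k \<Rightarrow> real^'m::finite) \<Rightarrow> real" where
  "B_b r phi = M_r r * M_phi phi"

definition R_w :: "('n::finite \<Rightarrow> 'k::finite \<Rightarrow> real) \<Rightarrow> ('n \<Rightarrow> 'k \<Rightarrow> real^'m::finite) \<Rightarrow> real \<Rightarrow> real" where
  "R_w r phi lam = max 1 (2 * B_b r phi / lam)"

definition K_set :: "('n::finite \<Rightarrow> 'k::finite \<Rightarrow> real) \<Rightarrow> ('n \<Rightarrow> 'k \<Rightarrow> real^'m::finite) \<Rightarrow>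
    real \<Rightarrow> real \<Rightarrow> ((real^'d::finite) \<times> (real^'m) \<times> (real^'n)) set" where
  "K_set r phi R lam = Theta R \<times> cball 0 (R_w r phi lam) \<times> prob_simplex"

definition generator_matrix :: "real^'n::finite^'n \<Rightarrow> bool" where
  "generator_matrix M \<longleftrightarrow>
     (\<forall>i j. i \<noteq> j \<longrightarrow> 0 \<le> M $ i $ j) \<and> (\<forall>i. M $ i $ i = - (\<Sum>j\<in>UNIV - {i}. M $ i $ j))"

section \<open>Semiflows and attractors\<close>

text \<open>\<open>X\<close>-valued solutions on $[0,\infty)$ (one-sided derivative at \<open>0\<close>); the values of
  \<open>x\<close> at negative times are irrelevant.\<close>
definition is_solution :: "'a::real_normed_vector set \<Rightarrow> ('a \<Rightarrow> 'a) \<Rightarrow> 'a \<Rightarrow> (real \<Rightarrow> 'a) \<Rightarrow> bool" where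
  "is_solution X F x0 x \<longleftrightarrow> x 0 = x0 \<and>
     (\<forall>t\<ge>0. x t \<in> X \<and> (x has_vector_derivative F (x t)) (at t within {0..}))"

text \<open>Meaningful for \<open>x0 \<in> X\<close> and \<open>t \<ge> 0\<close>, provided the solution through \<open>x0\<close> exists and is
  unique on $[0,\infty)$.\<close>
definition ode_flow :: "'a::real_normed_vector set \<Rightarrow> ('a \<Rightarrow> 'a) \<Rightarrow> real \<Rightarrow> 'a \<Rightarrow> 'a" where
  "ode_flow X F t x0 = (THE y. \<exists>x. is_solution X F x0 x \<and> x t = y)"

definition generates_semiflow ::
    "'a::real_normed_vector set \<Rightarrow> ('a \<Rightarrow> 'a \<Rightarrow> real) \<Rightarrow> ('a \<Rightarrow> 'a) \<Rightarrow> bool" where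
  "generates_semiflow X d F \<longleftrightarrow>
     (\<forall>x0\<in>X. \<exists>x. is_solution X F x0 x \<and>
        (\<forall>y. is_solution X F x0 y \<longrightarrow> (\<forall>t\<ge>0. y t = x t))) \<and>
     (\<forall>x0\<in>X. ode_flow X F 0 x0 = x0) \<and>
     (\<forall>t\<ge>0. \<forall>s\<ge>0. \<forall>x0\<in>X. ode_flow X F (t + s) x0 = ode_flow X F t (ode_flow X F s x0)) \<and>
     continuous_map (prod_topology (top_of_set {0..}) (Metric_space.mtopology X d))
       (Metric_space.mtopology X d) (\<lambda>(t, x0). ode_flow X F t x0)"

definition forward_invariant :: "(real \<Rightarrow> 'a \<Rightarrow> 'a) \<Rightarrow> 'a set \<Rightarrow> bool" where
  "forward_invariant S K \<longleftrightarrow> (\<forall>t\<ge>0. S t ` K \<subseteq> K)"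

definition absorbing :: "'a set \<Rightarrow> ('a \<Rightarrow> 'a \<Rightarrow> real) \<Rightarrow> (real \<Rightarrow> 'a \<Rightarrow> 'a) \<Rightarrow> 'a set \<Rightarrow> bool" where
  "absorbing X d S K \<longleftrightarrow>
     (\<forall>B. Metric_space.mbounded X d B \<longrightarrow> (\<exists>T\<ge>0. \<forall>t\<ge>T. S t ` B \<subseteq> K))"

text \<open>The supremum is taken in \<open>ennreal\<close>, so that it is \<open>0\<close> for \<open>B = {}\<close> and \<open>\<infinity>\<close> for
  an unbounded set of distances.\<close>
definition compact_global_attractor ::
    "'a set \<Rightarrow> ('a \<Rightarrow> 'a \<Rightarrow> real) \<Rightarrow> (real \<Rightarrow> 'a \<Rightarrow> 'a) \<Rightarrow> 'a set \<Rightarrow> bool" where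
  "compact_global_attractor X d S A \<longleftrightarrow>
     A \<noteq> {} \<and> compactin (Metric_space.mtopology X d) A \<and>
     (\<forall>t\<ge>0. S t ` A = A) \<and>
     (\<forall>B. Metric_space.mbounded X d B \<longrightarrow>
        ((\<lambda>t. SUP x\<in>B. INF y\<in>A. ennreal (d (S t x) y)) \<longlongrightarrow> 0) at_top)"

definition omega_limit ::
    "'a set \<Rightarrow> ('a \<Rightarrow> 'a \<Rightarrow> real) \<Rightarrow> (real \<Rightarrow> 'a \<Rightarrow> 'a) \<Rightarrow> 'a set \<Rightarrow> 'a set" where
  "omega_limit X d S K =
     (\<Inter>s\<in>{0..}. Metric_space.mtopology X d closure_of (\<Union>t\<in>{s..}. S t ` K))"

end

theory Submission
  imports Defs
begin

text \<open>For \<open>rho \<ge> R_w\<close> the slab \<open>C = Theta R \<times> cball 0 rho \<times> prob_simplex\<close> is compact and convex, the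
  vector field \<open>F\<close> is Lipschitz on it, and \<open>x + h F(x)\<close> stays in \<open>C\<close> for all \<open>x \<in> C\<close> and one small
  step size \<open>h\<close>: the factor $R_\theta^2 - \theta_j^2$ vanishes on the faces of the actor box, the generator
  property keeps the simplex, and for the critic
  $2 w \cdot (b - A w) \le - \lambda_c (|w|^2 - (B_b / \lambda_c)^2)$ while
  $R_w^2 \ge (B_b / \lambda_c)^2 + 1/4$. Hence the equation is the relaxation \<open>x' = (T x - x) / h\<close> towards
  a self-map \<open>T\<close> of \<open>C\<close>; its solutions exist globally and stay in \<open>C\<close>. Gronwall's inequality
  gives uniqueness and continuity of the flow, and the critic estimate makes \<open>K\<close> absorbing. The sets
  \<open>S t ` K\<close> then decrease in \<open>t\<close>, so that \<open>\<omega>(K)\<close> is their intersection, and the attractor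
  properties follow from compactness.\<close>

section \<open>Differential equations on convex sets\<close>

text \<open>Gronwall's inequality in differential form: \<open>exp (- c * s) * g s\<close> does not
  increase. Neither \<open>c\<close> nor \<open>g\<close> has a prescribed sign, so the same
  statement controls the growth of distances (\<open>c = 2 * L\<close>), the decay of the critic
  (\<open>c = - lam\<close>) and the separation from a convex set
  (\<open>c = - (1 / h)\<close>).\<close>

lemma linear_comparison:
  fixes g g' :: "real \<Rightarrow> real"
  assumes deriv: "\<And>s. 0 \<le> s \<Longrightarrow> (g has_real_derivative g' s) (at s within {0..})"
    and le: "\<And>s. 0 \<le> s \<Longrightarrow> g' s \<le> c * g s"
    and "0 \<le> t"
  shows "g t \<le> exp (c * t) * g 0"
proof -
  define h where "h s = exp (- c * s) * g s" for s
  have h_deriv: "(h has_real_derivative exp (- c * s) * (g' s - c * g s)) (at s within {0..})"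
    if "0 \<le> s" for s
  proof -
    have "((\<lambda>s. exp (- c * s)) has_real_derivative exp (- c * s) * (- c)) (at s within {0..})"
      by (auto intro!: derivative_eq_intros)
    from DERIV_mult[OF this deriv[OF that]] show ?thesis
      unfolding h_def by (rule DERIV_cong) (simp only: right_diff_distrib mult_minus_right mult_minus_left ac_simps uminus_add_conv_diff)
  qed
  have "h t \<le> h 0"
  \<comment> \<open>The mean value argument takes derivatives on the open interval only; at the
    endpoint \<open>0\<close>, where the derivative is one-sided, continuity is enough.\<close>
  proof (rule DERIV_nonpos_imp_decreasing_open[of 0 t h])
    fix s assume s: "0 < s" "s < t"
    then have "at s within {0..} = at s"
      by (intro at_within_interior) simp
    then have "(h has_real_derivative exp (- c * s) * (g' s - c * g s)) (at s)"
      using h_deriv[of s] s by simp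
    moreover have "exp (- c * s) * (g' s - c * g s) \<le> 0"
      using le[of s] s by (simp add: mult_nonneg_nonpos)
    ultimately show "\<exists>y. (h has_real_derivative y) (at s) \<and> y \<le> 0"
      by blast
  next
    have "continuous_on {0..} h"
      using h_deriv by (intro DERIV_continuous_on) auto
    then show "continuous_on {0..t} h"
      by (rule continuous_on_subset) auto
  qed (use \<open>0 \<le> t\<close> in simp)
  then have "exp (c * t) * (exp (- c * t) * g t) \<le> exp (c * t) * g 0"
    by (simp add: h_def)
  then show ?thesis
    by (simp add: exp_minus field_simps)
qed

text \<open>Integration against the weight gains a factor \<open>1 / k\<close>, which is what makes
  the Picard map a contraction for large \<open>k\<close>.\<close>

lemma integral_exp_le:
  fixes k :: real
  assumes "k > 0" "t \<ge> 0"
  shows "(\<lambda>s. exp (k * s)) integrable_on {0..t}" "k * integral {0..t} (\<lambda>s. exp (k * s)) \<le> exp (k * t)"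
proof -
  have "((\<lambda>s. exp (k * s)) has_integral (exp (k * t) / k - exp (k * 0) / k)) {0..t}"
    using assms
    by (intro fundamental_theorem_of_calculus)
      (auto intro!: derivative_eq_intros simp: has_real_derivative_iff_has_vector_derivative[symmetric])
  then show "(\<lambda>s. exp (k * s)) integrable_on {0..t}"
    "k * integral {0..t} (\<lambda>s. exp (k * s)) \<le> exp (k * t)"
    using assms by (auto simp: has_integral_iff field_simps)
qed

text \<open>The derivative at \<open>t\<close> depends only on a neighbourhood of \<open>t\<close>,
  so the half-line can be cut off at \<open>t + 1\<close> and the fundamental theorem of calculus on
  a compact interval applies.\<close>

lemma integral_has_vector_derivative_atLeast:
  fixes f :: "real \<Rightarrow> 'a::banach"
  assumes "continuous_on {0..} f" "0 \<le> t"
  shows "((\<lambda>u. integral {0..u} f) has_vector_derivative f t) (at t within {0..})"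
proof -
  have "((\<lambda>u. integral {0..u} f) has_vector_derivative f t) (at t within {0..t + 1})"
    using assms by (intro integral_has_vector_derivative continuous_on_subset[OF assms(1)]) auto
  moreover have "at t within {0..t + 1} = at t within {0..}"
    by (rule at_within_nhd[where S = "{..<t + 1}"]) auto
  ultimately show ?thesis
    by simp
qed

text \<open>Picard iteration contracts the norm \<open>SUP t. exp (- k * t) * norm (x t)\<close> once \<open>k\<close> exceeds the
  Lipschitz constant; the fixed point is sought for the rescaled function \<open>exp (- k * t) *\<^sub>R x t\<close>,
  which is bounded.\<close>
lemma lipschitz_ode_exists:
  fixes f :: "'a::banach \<Rightarrow> 'a"
  assumes lip: "L-lipschitz_on UNIV f"
  shows "\<exists>x. x 0 = x0 \<and> (\<forall>t\<ge>0. (x has_vector_derivative f (x t)) (at t within {0..}))"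
proof -
  have L0: "0 \<le> L"
    using lip by (rule lipschitz_on_nonneg)
  \<comment> \<open>The contraction factor is \<open>L / k\<close>, at most \<open>1 / 2\<close>;
    the summand \<open>1\<close> keeps \<open>k\<close> positive when \<open>L = 0\<close>.\<close>
  define k where "k = 2 * L + 1"
  have k: "0 < k" "2 * L \<le> k"
    using L0 by (auto simp: k_def)
  define F where "F z s = f (exp (k * s) *\<^sub>R apply_bcontfun z s)" for z s
  have f_cont: "continuous_on UNIV f"
    using lip by (rule lipschitz_on_continuous_on)
  have F_cont: "continuous_on A (F z)" for z A
    unfolding F_def by (rule continuous_on_compose2[OF f_cont]) (auto intro!: continuous_intros)
  have F_int: "F z integrable_on {0..t}" for z t
    by (intro integrable_continuous_real F_cont)
  define u where "u z t = integral {0..t} (F z)" for z t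
  have u_deriv: "(u z has_vector_derivative F z t) (at t within {0..})" if "0 \<le> t" for z t
    unfolding u_def by (rule integral_has_vector_derivative_atLeast[OF F_cont that])
  have u_cont: "continuous_on {0..} (u z)" for z
    using u_deriv has_vector_derivative_continuous by (force simp: continuous_on_eq_continuous_within)
  have u_diff: "exp (- k * t) * norm (u y t - u z t) \<le> dist y z / 2" if t: "0 \<le> t" for y z t
  proof -
    have "norm (u y t - u z t) = norm (integral {0..t} (\<lambda>s. F y s - F z s))"
      by (simp add: u_def integral_diff F_int)
    also have "\<dots> \<le> integral {0..t} (\<lambda>s. (L * dist y z) * exp (k * s))"
    proof (rule Henstock_Kurzweil_Integration.integral_norm_bound_integral)
      show "(\<lambda>s. F y s - F z s) integrable_on {0..t}"
        by (intro integrable_diff F_int)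
      show "(\<lambda>s. L * dist y z * exp (k * s)) integrable_on {0..t}"
        by (intro integrable_continuous_real continuous_intros)
      fix s
      have "norm (F y s - F z s) \<le> L * dist (exp (k * s) *\<^sub>R y s) (exp (k * s) *\<^sub>R z s)"
        using lipschitz_onD[OF lip] unfolding F_def dist_norm[symmetric] by auto
      also have "\<dots> = L * (exp (k * s) * dist (y s) (z s))"
        by (simp add: dist_norm scaleR_diff_right[symmetric])
      also have "\<dots> \<le> L * (exp (k * s) * dist y z)"
        using L0 by (intro mult_left_mono dist_bounded) auto
      finally show "norm (F y s - F z s) \<le> L * dist y z * exp (k * s)"
        by (simp add: ac_simps)
    qed
    also have "\<dots> = dist y z * (L * integral {0..t} (\<lambda>s. exp (k * s)))"
      by simp
    also have "\<dots> \<le> dist y z * (exp (k * t) / 2)"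
    proof (rule mult_left_mono)
      have "0 \<le> integral {0..t} (\<lambda>s. exp (k * s))"
        by (intro integral_nonneg integral_exp_le) (use k t in auto)
      then have "(2 * L) * integral {0..t} (\<lambda>s. exp (k * s)) \<le> k * integral {0..t} (\<lambda>s. exp (k * s))"
        using k by (intro mult_right_mono) auto
      then show "L * integral {0..t} (\<lambda>s. exp (k * s)) \<le> exp (k * t) / 2"
        using integral_exp_le(2)[OF k(1) t] by simp
    qed simp
    finally show ?thesis
      by (simp add: exp_minus field_simps)
  qed
  \<comment> \<open>Bounded continuous functions are taken on the whole line, so
    \<open>max 0 t\<close> extends the Picard image by its value at \<open>0\<close> to negative
    times.\<close>
  define P where "P z t = exp (- k * max 0 t) *\<^sub>R (x0 + u z (max 0 t))" for z t
  have P_diff: "norm (P y t - P z t) \<le> dist y z / 2" for y z t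
    using u_diff[of "max 0 t" y z]
    by (simp add: P_def scaleR_diff_right[symmetric])
  have P_bcont: "P z \<in> bcontfun" for z
  proof (rule bcontfun_normI)
    show "continuous_on UNIV (P z)"
      unfolding P_def
      by (intro continuous_intros continuous_on_compose2[OF u_cont]) auto
  next
    fix t
    \<comment> \<open>At \<open>z = 0\<close> the integrand is the constant \<open>f 0\<close>, and
      the linear growth is beaten by the weight. The estimate \<open>P_diff\<close> then carries
      boundedness over to every \<open>z\<close>.\<close>
    have "norm (P 0 t) \<le> norm x0 + norm (f 0) / k"
    proof -
      define s where "s = max 0 t"
      have s: "0 \<le> s" by (simp add: s_def)
      have "u 0 s = s *\<^sub>R f 0"
        using s by (simp add: u_def F_def[abs_def] zero_bcontfun.rep_eq)
      then have "norm (P 0 t) = exp (- k * s) * norm (x0 + s *\<^sub>R f 0)"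
        by (simp only: P_def s_def[symmetric] norm_scaleR abs_exp_cancel)
      also have "\<dots> \<le> exp (- k * s) * (norm x0 + s * norm (f 0))"
        using norm_triangle_ineq[of x0 "s *\<^sub>R f 0"] s by (intro mult_left_mono) auto
      also have "\<dots> = exp (- k * s) * norm x0 + exp (- k * s) * (k * s) * (norm (f 0) / k)"
        using k by (simp add: field_simps)
      also have "\<dots> \<le> 1 * norm x0 + 1 * (norm (f 0) / k)"
      proof (intro add_mono mult_right_mono)
        show "exp (- k * s) \<le> 1"
          using k s by simp
        show "exp (- k * s) * (k * s) \<le> 1"
        proof -
          have "k * s \<le> exp (k * s)"
            using exp_ge_add_one_self[of "k * s"] by linarith
          then show ?thesis
            by (simp add: exp_minus field_simps)
        qed
      qed (use k in auto)
      finally show ?thesis by simp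
    qed
    then show "norm (P z t) \<le> norm x0 + norm (f 0) / k + dist z 0 / 2"
      using P_diff[of z t 0] norm_triangle_ineq2[of "P z t" "P 0 t"] by linarith
  qed
  have "\<exists>!y. Bcontfun (P y) = y"
  proof (rule banach_fix_type[of "1/2"])
    show "\<forall>y z. dist (Bcontfun (P y)) (Bcontfun (P z)) \<le> 1 / 2 * dist y z"
    proof (intro allI dist_bound)
      fix y z t
      show "dist (Bcontfun (P y) t) (Bcontfun (P z) t) \<le> 1 / 2 * dist y z"
        using P_diff[of y t z] by (simp only: Bcontfun_inverse[OF P_bcont] dist_norm)
    qed
  qed auto
  then obtain y where "Bcontfun (P y) = y"
    by blast
  then have y: "apply_bcontfun y = P y"
    using Bcontfun_inverse[OF P_bcont, of y] by simp
  define x where "x t = x0 + u y t" for t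
  have x_eq: "x t = exp (k * t) *\<^sub>R y t" if "0 \<le> t" for t
  proof -
    have "max 0 t = t"
      using that by simp
    then show ?thesis
      unfolding y P_def x_def by (simp add: exp_minus)
  qed
  show ?thesis
  proof (intro exI[of _ x] conjI allI impI)
    show "x 0 = x0"
      by (simp add: x_def u_def)
    fix t :: real assume t: "0 \<le> t"
    have "(x has_vector_derivative F y t) (at t within {0..})"
      unfolding x_def using u_deriv[OF t] by (auto intro!: derivative_eq_intros)
    then show "(x has_vector_derivative f (x t)) (at t within {0..})"
      by (simp add: F_def x_eq[OF t])
  qed
qed

text \<open>On \<open>C\<close> the equation reads \<open>x' = (T x - x) / h\<close> with \<open>T x = x + h *\<^sub>R f x\<close> mapping into \<open>C\<close>.
  The right-hand side extends to the whole space through the metric projection onto \<open>C\<close>, and no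
  hyperplane that separates a point from \<open>C\<close> can be crossed.\<close>
lemma invariant_solution_exists:
  fixes f :: "'a::euclidean_space \<Rightarrow> 'a"
  assumes C: "convex C" "closed C"
    and lip: "L-lipschitz_on C f"
    and h: "h > 0" "\<And>x. x \<in> C \<Longrightarrow> x + h *\<^sub>R f x \<in> C"
    and x0: "x0 \<in> C"
  shows "\<exists>x. is_solution C f x0 x"
proof -
  have ne: "C \<noteq> {}"
    using x0 by auto
  define p where "p = closest_point C"
  have p_in: "p x \<in> C" for x
    unfolding p_def using C(2) ne by (rule closest_point_in_set)
  have p_lip: "1-lipschitz_on UNIV p"
    using closest_point_lipschitz[OF C ne] by (auto intro!: lipschitz_onI simp: p_def)
  \<comment> \<open>\<open>g\<close> pulls \<open>x\<close> towards the point
    \<open>p x + h *\<^sub>R f (p x)\<close> of \<open>C\<close>. It is globally Lipschitz and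
    agrees with \<open>f\<close> on \<open>C\<close>, where \<open>p\<close> is the
    identity.\<close>
  define g where "g x = (1 / h) *\<^sub>R (p x + h *\<^sub>R f (p x) - x)" for x
  have "(L * 1)-lipschitz_on UNIV (f \<circ> p)"
    by (rule lipschitz_on_compose[OF p_lip lipschitz_on_subset[OF lip]]) (use p_in in auto)
  then have "\<exists>M. M-lipschitz_on UNIV g"
    unfolding g_def o_def using p_lip by (intro exI) (rule lipschitz_intros; assumption?)+
  then obtain M where "M-lipschitz_on UNIV g" ..
  from lipschitz_ode_exists[OF this, of x0] obtain x where x: "x 0 = x0"
    "\<And>t. 0 \<le> t \<Longrightarrow> (x has_vector_derivative g (x t)) (at t within {0..})"
    by auto
  have x_in: "x t \<in> C" if t: "0 \<le> t" for t
  proof (rule ccontr)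
    assume "x t \<notin> C"
    then obtain a b where ab: "a \<bullet> x t < b" "\<And>y. y \<in> C \<Longrightarrow> a \<bullet> y > b"
      using separating_hyperplane_closed_point[OF C] by blast
    \<comment> \<open>The target of the relaxation always lies on the side of \<open>C\<close>,
      wherever \<open>x s\<close> is, so \<open>b - a \<bullet> x s\<close> grows no faster than the
      solution of \<open>y' = - y / h\<close>. Being negative at time \<open>0\<close>, it stays
      negative.\<close>
    have "b - a \<bullet> x t \<le> exp (- (1 / h) * t) * (b - a \<bullet> x 0)"
    proof (rule linear_comparison[OF _ _ t])
      fix s :: real assume s: "0 \<le> s"
      show "((\<lambda>s. b - a \<bullet> x s) has_real_derivative - (a \<bullet> g (x s))) (at s within {0..})"
        unfolding has_real_derivative_iff_has_vector_derivative
        using x(2)[OF s] by (auto intro!: derivative_eq_intros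
            bounded_linear.has_vector_derivative[OF bounded_linear_inner_right])
      have "b < a \<bullet> (p (x s) + h *\<^sub>R f (p (x s)))"
        by (intro ab h p_in)
      then have "(1 / h) * (b - a \<bullet> x s) \<le> (1 / h) * (a \<bullet> (p (x s) + h *\<^sub>R f (p (x s))) - a \<bullet> x s)"
        using h(1) by (intro mult_left_mono) auto
      then show "- (a \<bullet> g (x s)) \<le> - (1 / h) * (b - a \<bullet> x s)"
        by (simp add: g_def inner_diff_right)
    qed
    moreover have "exp (- (1 / h) * t) * (b - a \<bullet> x 0) < 0"
      using ab(2)[OF x0] x(1) by (intro mult_pos_neg) auto
    ultimately show False
      using ab(1) by linarith
  qed
  have "g (x t) = f (x t)" if "0 \<le> t" for t
    using x_in[OF that] h(1) by (simp add: g_def p_def closest_point_self)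
  then show ?thesis
    using x x_in unfolding is_solution_def by (metis)
qed

section \<open>Shifts and comparison of solutions, and the semiflow they form\<close>

lemma is_solution_cong:
  assumes x: "is_solution X F x0 x" and eq: "\<And>t. 0 \<le> t \<Longrightarrow> y t = x t"
  shows "is_solution X F x0 y"
  unfolding is_solution_def
proof (intro conjI allI impI)
  show "y 0 = x0"
    using x eq[of 0] by (simp add: is_solution_def)
  fix t :: real assume t: "0 \<le> t"
  show "y t \<in> X"
    using x t eq[of t] by (simp add: is_solution_def)
  have "(x has_vector_derivative F (x t)) (at t within {0..})"
    using x t by (simp add: is_solution_def)
  \<comment> \<open>A derivative within \<open>{0..}\<close> sees nonnegative times only, and there
    the two functions agree.\<close>
  then show "(y has_vector_derivative F (y t)) (at t within {0..})"
    unfolding eq[OF t] using eq t by (intro has_vector_derivative_transform[of t _ y x]) auto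
qed

text \<open>The equation is autonomous; with uniqueness this becomes the semigroup law.\<close>

lemma is_solution_shift:
  assumes x: "is_solution X F x0 x" and s: "0 \<le> s"
  shows "is_solution X F (x s) (\<lambda>t. x (t + s))"
  unfolding is_solution_def
proof (intro conjI allI impI)
  fix t :: real assume t: "0 \<le> t"
  show "x (t + s) \<in> X"
    using x t s by (simp add: is_solution_def)
  have "(x has_vector_derivative F (x (t + s))) (at (t + s) within (\<lambda>t. t + s) ` {0..})"
  proof (rule has_vector_derivative_within_subset)
    show "(x has_vector_derivative F (x (t + s))) (at (t + s) within {0..})"
      using x t s by (simp add: is_solution_def)
  qed (use s in auto)
  moreover have "((\<lambda>t. t + s) has_vector_derivative 1) (at t within {0..})"
    by (auto intro!: derivative_eq_intros)
  ultimately show "((\<lambda>t. x (t + s)) has_vector_derivative F (x (t + s))) (at t within {0..})"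
    using vector_diff_chain_within[of "\<lambda>t. t + s" 1 t "{0..}" x "F (x (t + s))"] by (simp add: o_def)
qed simp

text \<open>Gronwall's inequality for the squared distance, which is differentiable also where the
  solutions meet; taking the root turns the rate \<open>2 * L\<close> into \<open>L\<close>. Equal
  initial values give uniqueness, nearby ones give continuous dependence.\<close>

lemma solutions_dist_le:
  fixes F :: "'a::real_inner \<Rightarrow> 'a"
  assumes lip: "L-lipschitz_on C F"
    and x: "is_solution X F x0 x" "\<And>t. 0 \<le> t \<Longrightarrow> x t \<in> C"
    and y: "is_solution X F y0 y" "\<And>t. 0 \<le> t \<Longrightarrow> y t \<in> C"
    and t: "0 \<le> t"
  shows "dist (x t) (y t) \<le> exp (L * t) * dist x0 y0"
proof -
  define u where "u s = x s - y s" for s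
  have "u t \<bullet> u t \<le> exp (2 * L * t) * (u 0 \<bullet> u 0)"
  proof (rule linear_comparison[OF _ _ t])
    fix s :: real assume s: "0 \<le> s"
    have "(u has_vector_derivative F (x s) - F (y s)) (at s within {0..})"
      unfolding u_def using x(1) y(1) s
      by (auto simp: is_solution_def intro!: derivative_eq_intros)
    from bounded_bilinear.has_vector_derivative[OF bounded_bilinear_inner this this]
    show "((\<lambda>s. u s \<bullet> u s) has_real_derivative 2 * (u s \<bullet> (F (x s) - F (y s)))) (at s within {0..})"
      by (simp add: has_real_derivative_iff_has_vector_derivative inner_commute)
    have "u s \<bullet> (F (x s) - F (y s)) \<le> norm (u s) * norm (F (x s) - F (y s))"
      by (rule norm_cauchy_schwarz)
    also have "\<dots> \<le> norm (u s) * (L * norm (u s))"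
      using lipschitz_onD[OF lip x(2)[OF s] y(2)[OF s]]
      by (intro mult_left_mono) (auto simp: dist_norm u_def)
    finally show "2 * (u s \<bullet> (F (x s) - F (y s))) \<le> 2 * L * (u s \<bullet> u s)"
      by (simp add: power2_norm_eq_inner[symmetric] power2_eq_square ac_simps)
  qed
  then have "(dist (x t) (y t))\<^sup>2 \<le> exp (2 * L * t) * (dist (x 0) (y 0))\<^sup>2"
    by (simp add: dist_norm power2_norm_eq_inner u_def)
  also have "\<dots> = (exp (L * t) * dist (x 0) (y 0))\<^sup>2"
    by (simp only: power_mult_distrib exp_double mult.assoc)
  finally have "dist (x t) (y t) \<le> exp (L * t) * dist (x 0) (y 0)"
    by (rule power2_le_imp_le) simp
  then show ?thesis
    using x(1) y(1) by (simp add: is_solution_def)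
qed

text \<open>A global Lipschitz constant is replaced by one on each of a family of invariant sets
  covering the bounded subsets of \<open>X\<close>. Invariance is asked of every solution starting
  in \<open>C\<close>, so that one constant serves for all times and for uniqueness.\<close>

locale lipschitz_invariant_ode =
  fixes X :: "'a::euclidean_space set" and F :: "'a \<Rightarrow> 'a"
  assumes solution_exists: "x0 \<in> X \<Longrightarrow> \<exists>x. is_solution X F x0 x"
    and lipschitz_invariant_cover: "\<lbrakk>bounded B; B \<subseteq> X\<rbrakk> \<Longrightarrow> \<exists>C L. B \<subseteq> C \<and> L-lipschitz_on C F \<and>
      (\<forall>x0\<in>C. \<forall>x. is_solution X F x0 x \<longrightarrow> (\<forall>t\<ge>0. x t \<in> C))"
begin

lemma solution_unique:
  assumes x: "is_solution X F x0 x" and y: "is_solution X F x0 y" and t: "0 \<le> t"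
  shows "y t = x t"
proof -
  have "x0 \<in> X"
    using x by (auto simp: is_solution_def)
  with lipschitz_invariant_cover[of "{x0}"] obtain C L where C: "x0 \<in> C" "L-lipschitz_on C F"
    "\<And>z t. is_solution X F x0 z \<Longrightarrow> 0 \<le> t \<Longrightarrow> z t \<in> C"
    by auto
  have "dist (x t) (y t) \<le> exp (L * t) * dist x0 x0"
    by (rule solutions_dist_le[OF C(2) x C(3)[OF x] y C(3)[OF y] t])
  then show ?thesis
    by simp
qed

lemma ode_flow_eq:
  assumes x: "is_solution X F x0 x" and t: "0 \<le> t"
  shows "ode_flow X F t x0 = x t"
  unfolding ode_flow_def
  using x solution_unique[OF x _ t] by (intro the_equality) blast+

lemma is_solution_ode_flow:
  assumes "x0 \<in> X"
  shows "is_solution X F x0 (\<lambda>t. ode_flow X F t x0)"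
proof -
  obtain x where x: "is_solution X F x0 x"
    using solution_exists[OF assms] ..
  then show ?thesis
    by (rule is_solution_cong) (rule ode_flow_eq[OF x])
qed

lemma ode_flow_in: "x0 \<in> X \<Longrightarrow> 0 \<le> t \<Longrightarrow> ode_flow X F t x0 \<in> X"
  using is_solution_ode_flow by (simp add: is_solution_def)

lemma ode_flow_0: "x0 \<in> X \<Longrightarrow> ode_flow X F 0 x0 = x0"
  using is_solution_ode_flow by (simp add: is_solution_def)

lemma ode_flow_add:
  assumes "x0 \<in> X" "0 \<le> s" "0 \<le> t"
  shows "ode_flow X F (t + s) x0 = ode_flow X F t (ode_flow X F s x0)"
  using ode_flow_eq[OF is_solution_shift[OF is_solution_ode_flow[OF assms(1)] assms(2)] assms(3)] by simp

text \<open>The step from \<open>(s, y)\<close> to \<open>(t, x)\<close> passes through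
  \<open>(s, x)\<close>: the change of the initial value is controlled by Gronwall's inequality, the
  change of time by continuity of the single trajectory through \<open>x\<close>.\<close>

lemma continuous_on_ode_flow: "continuous_on ({0..} \<times> X) (\<lambda>(t, x0). ode_flow X F t x0)"
  unfolding continuous_on_iff
proof (intro ballI allI impI)
  fix p :: "real \<times> 'a" and e :: real assume p: "p \<in> {0..} \<times> X" and e: "0 < e"
  obtain t x where tx: "p = (t, x)" "0 \<le> t" "x \<in> X"
    using p by (cases p) auto
  let ?S = "\<lambda>t x. ode_flow X F t x"
  obtain C L where C: "X \<inter> ball x 1 \<subseteq> C" "L-lipschitz_on C F"
    "\<And>x0 z t. x0 \<in> C \<Longrightarrow> is_solution X F x0 z \<Longrightarrow> 0 \<le> t \<Longrightarrow> z t \<in> C"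
    using lipschitz_invariant_cover[of "X \<inter> ball x 1"] bounded_subset[OF bounded_ball[of x 1]] by blast
  have L: "0 \<le> L"
    using C(2) by (rule lipschitz_on_nonneg)
  have "((\<lambda>t. ?S t x) has_vector_derivative F (?S t x)) (at t within {0..})"
    using is_solution_ode_flow[OF tx(3)] tx(2) by (simp add: is_solution_def)
  then have "continuous (at t within {0..}) (\<lambda>t. ?S t x)"
    by (rule has_vector_derivative_continuous)
  then obtain d where d: "0 < d" "\<And>s. 0 \<le> s \<Longrightarrow> dist s t < d \<Longrightarrow> dist (?S s x) (?S t x) < e / 2"
    using e unfolding continuous_within_eps_delta by (metis atLeast_iff half_gt_zero)
  \<comment> \<open>The bound \<open>1\<close> keeps \<open>y\<close> in the unit ball around
    \<open>x\<close> and \<open>s\<close> below \<open>t + 1\<close>; \<open>d\<close> controls the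
    change of time; the third entry compensates the Gronwall factor up to time
    \<open>t + 1\<close>.\<close>
  define c where "c = Min {1, d, e / (2 * exp (L * (t + 1)))}"
  have c: "0 < c" "c \<le> 1" "c \<le> d" "c \<le> e / (2 * exp (L * (t + 1)))"
    using d e by (auto simp: c_def)
  show "\<exists>c>0. \<forall>q\<in>{0..} \<times> X. dist q p < c \<longrightarrow>
      dist (case q of (t, x0) \<Rightarrow> ?S t x0) (case p of (t, x0) \<Rightarrow> ?S t x0) < e"
  proof (intro exI[of _ c] conjI ballI impI c(1))
    fix q :: "real \<times> 'a" assume q: "q \<in> {0..} \<times> X" "dist q p < c"
    obtain s y where sy: "q = (s, y)" "0 \<le> s" "y \<in> X"
      using q by (cases q) auto
    have near: "dist s t < c" "dist y x < c"
      using q(2) dist_fst_le[of q p] dist_snd_le[of q p] by (auto simp: sy tx)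
    have inC: "x \<in> C" "y \<in> C"
      using C(1) near c(2) sy tx by (auto simp: dist_commute)
    have "dist (?S s y) (?S s x) \<le> exp (L * s) * dist y x"
      by (rule solutions_dist_le[OF C(2) is_solution_ode_flow[OF sy(3)] C(3)[OF inC(2) is_solution_ode_flow[OF sy(3)]]
          is_solution_ode_flow[OF tx(3)] C(3)[OF inC(1) is_solution_ode_flow[OF tx(3)]] sy(2)])
    also have "\<dots> \<le> exp (L * (t + 1)) * dist y x"
      using near c(2) L by (intro mult_right_mono) (auto simp: dist_real_def intro!: mult_left_mono)
    also have "\<dots> < exp (L * (t + 1)) * (e / (2 * exp (L * (t + 1))))"
      using near c(4) by (intro mult_strict_left_mono) auto
    also have "\<dots> = e / 2"
      by simp
    finally have "dist (?S s y) (?S s x) < e / 2" .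
    moreover have "dist (?S s x) (?S t x) < e / 2"
      using near c(3) by (intro d(2) sy(2)) auto
    ultimately have "dist (?S s y) (?S t x) < e"
      using dist_triangle[of "?S s y" "?S t x" "?S s x"] by linarith
    then show "dist (case q of (t, x0) \<Rightarrow> ?S t x0) (case p of (t, x0) \<Rightarrow> ?S t x0) < e"
      by (simp add: sy tx)
  qed
qed

lemma generates_semiflow:
  assumes top: "Metric_space.mtopology X d = top_of_set X"
  shows "generates_semiflow X d F"
  unfolding generates_semiflow_def top
proof (intro conjI ballI allI impI)
  fix x0 assume "x0 \<in> X"
  then show "\<exists>x. is_solution X F x0 x \<and> (\<forall>y. is_solution X F x0 y \<longrightarrow> (\<forall>t\<ge>0. y t = x t))"
    using solution_exists solution_unique by blast
next
  fix x0 assume "x0 \<in> X"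
  then show "ode_flow X F 0 x0 = x0"
    by (rule ode_flow_0)
next
  fix t s :: real and x0 assume "0 \<le> t" "0 \<le> s" "x0 \<in> X"
  then show "ode_flow X F (t + s) x0 = ode_flow X F t (ode_flow X F s x0)"
    by (intro ode_flow_add)
next
  have "continuous_map (top_of_set ({0..} \<times> X)) (top_of_set X) (\<lambda>(t, x0). ode_flow X F t x0)"
    using continuous_on_ode_flow ode_flow_in by (auto simp: continuous_map_subtopology_eu)
  then show "continuous_map (prod_topology (top_of_set {0..}) (top_of_set X)) (top_of_set X)
      (\<lambda>(t, x0). ode_flow X F t x0)"
    by (simp add: subtopology_Times[symmetric] euclidean_product_topology)
qed

end

section \<open>Global attractors of dissipative semiflows\<close>

text \<open>Cantor's intersection theorem, applied in the compact subspace \<open>K\<close>.\<close>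

lemma compactin_decreasing_Inter:
  fixes Z :: "nat \<Rightarrow> 'a set"
  assumes K: "compactin T K" and Z: "\<And>n. closedin T (Z n)" "\<And>n. Z n \<noteq> {}" "\<And>n. Z n \<subseteq> K" "decseq Z"
  shows "(\<Inter>n. Z n) \<noteq> {}"
proof (rule compact_space_imp_nest)
  show "compact_space (subtopology T K)"
    using K by (rule compact_space_subtopology)
  show "closedin (subtopology T K) (Z n)" for n
    using Z(1,3) by (simp add: closedin_subset_topspace)
qed (use Z in auto)

locale dissipative_semiflow = Metric_space M d
  for M :: "'a set" and d +
  fixes S :: "real \<Rightarrow> 'a \<Rightarrow> 'a" and K :: "'a set"
  assumes continuous_semiflow:
      "continuous_map (prod_topology (top_of_set {0..}) mtopology) mtopology (\<lambda>(t, x). S t x)"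
    and semiflow_add: "\<And>s t x. 0 \<le> s \<Longrightarrow> 0 \<le> t \<Longrightarrow> x \<in> M \<Longrightarrow> S (t + s) x = S t (S s x)"
    and compact_K: "compactin mtopology K" and K_nonempty: "K \<noteq> {}"
    and invariant_K: "forward_invariant S K"
    and absorbing_K: "absorbing M d S K"
begin

lemma continuous_S: "continuous_map mtopology mtopology (S t)" if "0 \<le> t"
proof -
  have "continuous_map mtopology (prod_topology (top_of_set {0..}) mtopology) (\<lambda>x. (t, x))"
    using that by (intro continuous_map_pairedI) auto
  from continuous_map_compose[OF this continuous_semiflow] show ?thesis
    by (simp add: o_def)
qed

lemma K_subset: "K \<subseteq> M"
  using compactin_subset_topspace[OF compact_K] by simp

lemma S_K_subset: "S t ` K \<subseteq> K" if "0 \<le> t"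
  using invariant_K that by (auto simp: forward_invariant_def)

text \<open>Running first for time \<open>t - s\<close> stays in \<open>K\<close>, and the remaining
  time is \<open>s\<close>.\<close>

lemma S_K_antimono: "S t ` K \<subseteq> S s ` K" if "0 \<le> s" "s \<le> t"
proof -
  have "S t x = S s (S (t - s) x)" if "x \<in> K" for x
    using semiflow_add[of "t - s" s x] K_subset that \<open>0 \<le> s\<close> \<open>s \<le> t\<close> by auto
  then show ?thesis
    using S_K_subset[of "t - s"] that by auto
qed

lemma compactin_S_K: "compactin mtopology (S t ` K)" if "0 \<le> t"
  using compact_K continuous_S[OF that] by (rule image_compactin)

lemma closedin_S_K: "closedin mtopology (S t ` K)" if "0 \<le> t"
  using Hausdorff_space_mtopology compactin_S_K[OF that] by (rule compactin_imp_closedin)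

text \<open>By monotonicity each tail union equals its first member, which is compact and hence
  already closed.\<close>

lemma omega_limit_eq: "omega_limit M d S K = (\<Inter>s\<in>{0..}. S s ` K)"
proof -
  have "mtopology closure_of (\<Union>t\<in>{s..}. S t ` K) = S s ` K" if "0 \<le> s" for s
  proof -
    have "(\<Union>t\<in>{s..}. S t ` K) = S s ` K"
      using S_K_antimono[OF that] by force
    then show ?thesis
      using closedin_S_K[OF that] by (simp add: closure_of_closedin)
  qed
  then show ?thesis
    by (simp add: omega_limit_def)
qed

lemma omega_limit_eq_nat: "omega_limit M d S K = (\<Inter>n. S (real n) ` K)"
proof -
  have "x \<in> S s ` K" if x: "\<forall>n. x \<in> S (real n) ` K" and "0 \<le> s" for x s
  proof -
    obtain n where "s \<le> real n"
      using real_arch_simple by blast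
    then show ?thesis
      using S_K_antimono[OF \<open>0 \<le> s\<close>] x by blast
  qed
  then show ?thesis
    unfolding omega_limit_eq by auto
qed

lemma decseq_S_K: "decseq (\<lambda>n. S (real n) ` K)"
  by (intro decseq_SucI S_K_antimono) auto

lemma omega_limit_nonempty: "omega_limit M d S K \<noteq> {}"
  unfolding omega_limit_eq_nat
  by (rule compactin_decreasing_Inter[OF compact_K closedin_S_K _ S_K_subset decseq_S_K])
    (use K_nonempty in auto)

lemma omega_limit_subset: "omega_limit M d S K \<subseteq> K"
  using S_K_subset[of 0] by (auto simp: omega_limit_eq)

lemma compactin_omega_limit: "compactin mtopology (omega_limit M d S K)"
proof (rule closed_compactin[OF compact_K omega_limit_subset])
  show "closedin mtopology (omega_limit M d S K)"
    unfolding omega_limit_eq by (intro closedin_INT closedin_S_K) auto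
qed

lemma S_omega_limit: "S t ` omega_limit M d S K = omega_limit M d S K" if t: "0 \<le> t"
proof
  show "S t ` omega_limit M d S K \<subseteq> omega_limit M d S K"
  proof -
    have "S t x \<in> S s ` K" if x: "x \<in> omega_limit M d S K" and s: "0 \<le> s" for x s
    proof -
      obtain y where y: "y \<in> K" "x = S s y"
        using x s by (auto simp: omega_limit_eq)
      then have "S t x = S s (S t y)"
        using semiflow_add[of s t y] semiflow_add[of t s y] s t K_subset by (auto simp: add.commute)
      then show ?thesis
        using y S_K_subset[OF t] by blast
    qed
    then show ?thesis
      by (auto simp: omega_limit_eq)
  qed
  show "omega_limit M d S K \<subseteq> S t ` omega_limit M d S K"
  proof
    fix x assume x: "x \<in> omega_limit M d S K"
    \<comment> \<open>The fibre of \<open>S t\<close> over \<open>x\<close> inside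
      \<open>S n\<close> K\<open>, written as the preimage of a closed set. It is nonempty
      since\<close>x\<open>also lies in\<close>S (t + n) \<open>K\<close>.\<close>
    define Z where "Z n = {y \<in> S (real n) ` K. S t y \<in> {x}}" for n
    have xM: "x \<in> M"
      using x omega_limit_subset K_subset by blast
    have "(\<Inter>n. Z n) \<noteq> {}"
    proof (rule compactin_decreasing_Inter[OF compact_K])
      fix n
      have "closedin mtopology {x}"
        using xM by (simp add: closedin_Hausdorff_singleton Hausdorff_space_mtopology)
      then show "closedin mtopology (Z n)"
        unfolding Z_def by (intro closedin_continuous_map_preimage_gen[OF continuous_S[OF t]] closedin_S_K) auto
      show "Z n \<subseteq> K"
        using S_K_subset[of n] by (auto simp: Z_def)
      have "x \<in> S (t + real n) ` K"
        using x t by (auto simp: omega_limit_eq)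
      then obtain y where y: "y \<in> K" "x = S (t + real n) y"
        by blast
      then have "S (real n) y \<in> Z n"
        using semiflow_add[of n t y] t K_subset by (auto simp: Z_def)
      then show "Z n \<noteq> {}"
        by blast
    next
      show "decseq Z"
        using decseq_S_K by (fastforce simp: Z_def decseq_def)
    qed
    then obtain y where "\<And>n. y \<in> Z n"
      by blast
    then have "y \<in> omega_limit M d S K" "S t y = x"
      by (auto simp: Z_def omega_limit_eq_nat)
    then show "x \<in> S t ` omega_limit M d S K"
      by blast
  qed
qed

lemma S_K_near_omega_limit:
  assumes "0 < e"
  obtains n :: nat where "S (real n) ` K \<subseteq> (\<Union>y\<in>omega_limit M d S K. mball y e)"
proof -
  define U where "U = (\<Union>y\<in>omega_limit M d S K. mball y e)"
  have U: "openin mtopology U"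
    unfolding U_def by blast
  have omega_U: "omega_limit M d S K \<subseteq> U"
    using omega_limit_subset K_subset assms by (force simp: U_def)
  have "\<exists>n. S (real n) ` K \<subseteq> U"
  proof (rule ccontr)
    assume no: "\<nexists>n. S (real n) ` K \<subseteq> U"
    have "(\<Inter>n. S (real n) ` K - U) \<noteq> {}"
    proof (rule compactin_decreasing_Inter[OF compact_K])
      show "closedin mtopology (S (real n) ` K - U)" for n
        by (intro closedin_diff closedin_S_K U) auto
      show "S (real n) ` K - U \<noteq> {}" for n
        using no by blast
      show "S (real n) ` K - U \<subseteq> K" for n
        using S_K_subset[of n] by auto
      show "decseq (\<lambda>n. S (real n) ` K - U)"
        using decseq_S_K by (fastforce simp: decseq_def)
    qed
    then show False
      using omega_U by (auto simp: omega_limit_eq_nat)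
  qed
  then show ?thesis
    using that by (auto simp: U_def)
qed

text \<open>After time \<open>T\<close> the set \<open>B\<close> has entered \<open>K\<close>, and
  \<open>n\<close> further units of time bring \<open>K\<close> close to the omega-limit
  set.\<close>

lemma omega_limit_attracts:
  assumes B: "mbounded B"
  shows "((\<lambda>t. SUP x\<in>B. INF y\<in>omega_limit M d S K. ennreal (d (S t x) y)) \<longlongrightarrow> 0) at_top"
proof (rule order_tendstoI)
  fix e :: ennreal assume "0 < e"
  \<comment> \<open>A bound by \<open>c\<close> on every infimum bounds the supremum by
    \<open>c\<close> only weakly, so \<open>c\<close> is taken strictly below \<open>e\<close>; this
    also makes it finite, hence a real radius.\<close>
  then obtain c where c: "0 < c" "c < e"
    using dense by blast
  obtain r where r: "c = ennreal r" "0 < r"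
  proof (cases c)
    case (real r)
    then show ?thesis
      using c that by auto
  qed (use c in auto)
  obtain n :: nat where n: "S (real n) ` K \<subseteq> (\<Union>y\<in>omega_limit M d S K. mball y r)"
    using S_K_near_omega_limit[OF \<open>0 < r\<close>] .
  obtain T where T: "0 \<le> T" "\<And>t. T \<le> t \<Longrightarrow> S t ` B \<subseteq> K"
    using absorbing_K B by (auto simp: absorbing_def)
  have BM: "B \<subseteq> M"
    using B mbounded_subset_mspace by blast
  have "(SUP x\<in>B. INF y\<in>omega_limit M d S K. ennreal (d (S t x) y)) < e" if t: "T + real n \<le> t" for t
  proof -
    have "(INF y\<in>omega_limit M d S K. ennreal (d (S t x) y)) \<le> c" if x: "x \<in> B" for x
    proof -
      have "S t x = S n (S (t - n) x)"
        using semiflow_add[of "t - n" n x] t T(1) x BM by auto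
      moreover have "S (t - n) x \<in> K"
        using T(2)[of "t - n"] t x by auto
      ultimately obtain y where y: "y \<in> omega_limit M d S K" "S t x \<in> mball y r"
        using n by auto
      then have "d (S t x) y \<le> r"
        by (simp add: commute)
      then have "ennreal (d (S t x) y) \<le> c"
        unfolding r by (rule ennreal_leI)
      then show ?thesis
        using y(1) by (rule INF_lower2[rotated])
    qed
    then show ?thesis
      using c(2) by (intro le_less_trans[OF SUP_least]) auto
  qed
  then show "\<forall>\<^sub>F t in at_top. (SUP x\<in>B. INF y\<in>omega_limit M d S K. ennreal (d (S t x) y)) < e"
    by (auto simp: eventually_at_top_linorder)
qed simp

theorem compact_global_attractor_omega_limit:
  "compact_global_attractor M d S (omega_limit M d S K)"
  unfolding compact_global_attractor_def
  using omega_limit_nonempty compactin_omega_limit S_omega_limit omega_limit_attracts by auto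

end

section \<open>Uniqueness of the global attractor\<close>

context Metric_space
begin

text \<open>\<open>A\<close> is bounded, so \<open>A'\<close> attracts it; but \<open>A\<close> does
  not move, so each of its points is at distance zero from the closed set \<open>A'\<close>.\<close>

lemma compact_global_attractor_subset:
  assumes A: "compact_global_attractor M d S A" and A': "compact_global_attractor M d S A'"
  shows "A \<subseteq> A'"
proof
  fix x assume x: "x \<in> A"
  have cpt: "compactin mtopology A" "compactin mtopology A'"
    and inv: "\<And>t. 0 \<le> t \<Longrightarrow> S t ` A = A"
    using A A' by (auto simp: compact_global_attractor_def)
  have sub: "A \<subseteq> M" "A' \<subseteq> M"
    using cpt compactin_subset_topspace by force+
  have lim: "((\<lambda>t. SUP x\<in>A. INF y\<in>A'. ennreal (d (S t x) y)) \<longlongrightarrow> 0) at_top"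
    using A' compactin_imp_mbounded[OF cpt(1)] by (simp add: compact_global_attractor_def)
  have "(INF y\<in>A'. ennreal (d x y)) \<le> (SUP z\<in>A. INF y\<in>A'. ennreal (d (S t z) y))" if t: "0 \<le> t" for t
  proof -
    obtain z where "z \<in> A" "x = S t z"
      using inv[OF t] x by blast
    then show ?thesis
      by (auto intro: SUP_upper2)
  qed
  \<comment> \<open>The left-hand side does not depend on \<open>t\<close>, so the limit of the
    upper bounds applies to it.\<close>
  then have "(INF y\<in>A'. ennreal (d x y)) \<le> 0"
    by (intro tendsto_lowerbound[OF lim] eventually_mono[OF eventually_ge_at_top[of 0]]) auto
  then have inf0: "(INF y\<in>A'. ennreal (d x y)) = 0"
    by simp
  have "\<exists>y\<in>A'. y \<in> mball x r" if "0 < r" for r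
  proof -
    have "(INF y\<in>A'. ennreal (d x y)) < ennreal r"
      using that by (simp add: inf0)
    then obtain y where "y \<in> A'" "ennreal (d x y) < ennreal r"
      by (auto simp: INF_less_iff)
    then show ?thesis
      using x sub by (auto simp: ennreal_less_iff)
  qed
  then have "x \<in> mtopology closure_of A'"
    using x sub by (auto simp: metric_closure_of)
  then show "x \<in> A'"
    using compactin_imp_closedin[OF Hausdorff_space_mtopology cpt(2)] by (simp add: closure_of_closedin)
qed

lemma compact_global_attractor_unique:
  "compact_global_attractor M d S A \<Longrightarrow> compact_global_attractor M d S A' \<Longrightarrow> A = A'"
  by (simp add: compact_global_attractor_subset subset_antisym)

end

section \<open>Lipschitz functions on compact sets\<close>

text \<open>The constant is hidden so that the closure properties below chain as introduction rules
  along the structure of a formula.\<close>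

definition lipschitzian_on :: "'a::metric_space set \<Rightarrow> ('a \<Rightarrow> 'b::metric_space) \<Rightarrow> bool" where
  "lipschitzian_on C f \<longleftrightarrow> (\<exists>L. L-lipschitz_on C f)"

lemma lipschitzian_onI:
  assumes "\<And>x y. x \<in> C \<Longrightarrow> y \<in> C \<Longrightarrow> dist (f x) (f y) \<le> L * dist x y"
  shows "lipschitzian_on C f"
  unfolding lipschitzian_on_def
proof
  \<comment> \<open>\<open>L\<close> may be negative here, while \<open>lipschitz_on\<close>
    includes nonnegativity of its constant.\<close>
  show "(max L 0)-lipschitz_on C f"
  proof (rule lipschitz_onI)
    fix x y assume "x \<in> C" "y \<in> C"
    from assms[OF this] show "dist (f x) (f y) \<le> max L 0 * dist x y"
      by (rule order_trans) (intro mult_right_mono, auto)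
  qed simp
qed

lemma lipschitzian_onE:
  assumes "lipschitzian_on C f"
  obtains L where "0 \<le> L" "\<And>x y. x \<in> C \<Longrightarrow> y \<in> C \<Longrightarrow> dist (f x) (f y) \<le> L * dist x y"
  using assms lipschitz_on_nonneg lipschitz_onD unfolding lipschitzian_on_def by metis

lemma lipschitzian_on_const: "lipschitzian_on C (\<lambda>x. c)"
  by (rule lipschitzian_onI[of _ _ 0]) simp

lemma lipschitzian_on_compose:
  assumes "lipschitzian_on C f" "lipschitzian_on D g" "f ` C \<subseteq> D"
  shows "lipschitzian_on C (\<lambda>x. g (f x))"
proof -
  obtain L where L: "0 \<le> L" "\<And>x y. x \<in> C \<Longrightarrow> y \<in> C \<Longrightarrow> dist (f x) (f y) \<le> L * dist x y"
    by (rule lipschitzian_onE[OF assms(1)]) (rule that)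
  obtain M where M: "0 \<le> M" "\<And>x y. x \<in> D \<Longrightarrow> y \<in> D \<Longrightarrow> dist (g x) (g y) \<le> M * dist x y"
    by (rule lipschitzian_onE[OF assms(2)]) (rule that)
  show ?thesis
  proof (rule lipschitzian_onI)
    fix x y assume xy: "x \<in> C" "y \<in> C"
    then have "dist (g (f x)) (g (f y)) \<le> M * dist (f x) (f y)"
      using assms(3) by (intro M) auto
    also have "\<dots> \<le> M * (L * dist x y)"
      using L(2)[OF xy] M(1) by (rule mult_left_mono)
    finally show "dist (g (f x)) (g (f y)) \<le> (M * L) * dist x y"
      by (simp add: mult.assoc)
  qed
qed

lemma lipschitzian_on_add:
  fixes f g :: "'a::metric_space \<Rightarrow> 'b::real_normed_vector"
  assumes "lipschitzian_on C f" "lipschitzian_on C g"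
  shows "lipschitzian_on C (\<lambda>x. f x + g x)"
  using assms lipschitz_on_add unfolding lipschitzian_on_def by blast

lemma lipschitzian_on_diff:
  fixes f g :: "'a::metric_space \<Rightarrow> 'b::real_normed_vector"
  assumes "lipschitzian_on C f" "lipschitzian_on C g"
  shows "lipschitzian_on C (\<lambda>x. f x - g x)"
  using assms lipschitz_on_diff unfolding lipschitzian_on_def by blast

lemma lipschitzian_on_Pair:
  assumes "lipschitzian_on C f" "lipschitzian_on C g"
  shows "lipschitzian_on C (\<lambda>x. (f x, g x))"
  using assms lipschitz_on_Pair unfolding lipschitzian_on_def by blast

lemma lipschitzian_on_sum:
  fixes f :: "'i \<Rightarrow> 'a::metric_space \<Rightarrow> 'b::real_normed_vector"
  assumes "\<And>i. i \<in> I \<Longrightarrow> lipschitzian_on C (f i)"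
  shows "lipschitzian_on C (\<lambda>x. \<Sum>i\<in>I. f i x)"
  using assms
  by (induction I rule: infinite_finite_induct) (simp_all add: lipschitzian_on_const lipschitzian_on_add)

lemma lipschitzian_on_bounded_linear: "bounded_linear f \<Longrightarrow> lipschitzian_on C f"
  using bounded_linear.lipschitz_boundE unfolding lipschitzian_on_def by metis

lemma lipschitzian_on_linear:
  "bounded_linear g \<Longrightarrow> lipschitzian_on C f \<Longrightarrow> lipschitzian_on C (\<lambda>x. g (f x))"
  by (rule lipschitzian_on_compose[OF _ lipschitzian_on_bounded_linear[of g UNIV]]) auto

lemma lipschitzian_on_fst:
  fixes C :: "('a::real_normed_vector \<times> 'b::real_normed_vector) set"
  shows "lipschitzian_on C fst"
  by (rule lipschitzian_on_bounded_linear[OF bounded_linear_fst])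

lemma lipschitzian_on_fst_snd:
  fixes C :: "('a::real_normed_vector \<times> 'b::real_normed_vector \<times> 'c::real_normed_vector) set"
  shows "lipschitzian_on C (\<lambda>x. fst (snd x))"
  by (rule lipschitzian_on_linear[OF bounded_linear_fst lipschitzian_on_bounded_linear[OF bounded_linear_snd]])

lemma lipschitzian_on_snd_snd:
  fixes C :: "('a::real_normed_vector \<times> 'b::real_normed_vector \<times> 'c::real_normed_vector) set"
  shows "lipschitzian_on C (\<lambda>x. snd (snd x))"
  by (rule lipschitzian_on_linear[OF bounded_linear_snd lipschitzian_on_bounded_linear[OF bounded_linear_snd]])

lemma lipschitzian_on_vec:
  fixes f :: "'a::metric_space \<Rightarrow> real^'n::finite"
  assumes "\<And>i. lipschitzian_on C (\<lambda>x. f x $ i)"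
  shows "lipschitzian_on C f"
proof -
  have "\<exists>L. \<forall>x\<in>C. \<forall>y\<in>C. dist (f x $ i) (f y $ i) \<le> L * dist x y" for i
    using assms[of i] by (meson lipschitzian_onE)
  then obtain L where L: "\<And>i x y. x \<in> C \<Longrightarrow> y \<in> C \<Longrightarrow> dist (f x $ i) (f y $ i) \<le> L i * dist x y"
    by metis
  show ?thesis
  proof (rule lipschitzian_onI)
    fix x y assume xy: "x \<in> C" "y \<in> C"
    have "dist (f x) (f y) \<le> (\<Sum>i\<in>UNIV. dist (f x $ i) (f y $ i))"
      unfolding dist_norm real_norm_def using norm_le_l1_cart[of "f x - f y"] by simp
    also have "\<dots> \<le> (\<Sum>i\<in>UNIV. L i * dist x y)"
      by (intro sum_mono L xy)
    finally show "dist (f x) (f y) \<le> (\<Sum>i\<in>UNIV. L i) * dist x y"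
      by (simp add: sum_distrib_right)
  qed
qed

lemma lipschitzian_on_continuous: "lipschitzian_on C f \<Longrightarrow> continuous_on C f"
  using lipschitz_on_continuous_on by (auto simp: lipschitzian_on_def)

lemma lipschitzian_on_norm_bound:
  fixes f :: "'a::metric_space \<Rightarrow> 'b::real_normed_vector"
  assumes "lipschitzian_on C f" "compact C"
  obtains B where "0 < B" "\<And>x. x \<in> C \<Longrightarrow> norm (f x) \<le> B"
  using compact_imp_bounded[OF compact_continuous_image[OF lipschitzian_on_continuous[OF assms(1)] assms(2)]]
  by (force simp: bounded_pos)

text \<open>Compactness bounds both factors, and the difference of two products is split as in the
  product rule.\<close>

lemma lipschitzian_on_bilinear:
  fixes f :: "'a::metric_space \<Rightarrow> 'b::real_normed_vector"
    and g :: "'a \<Rightarrow> 'c::real_normed_vector"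
    and prod :: "'b \<Rightarrow> 'c \<Rightarrow> 'd::real_normed_vector"
  assumes prod: "bounded_bilinear prod" and C: "compact C"
    and f: "lipschitzian_on C f" and g: "lipschitzian_on C g"
  shows "lipschitzian_on C (\<lambda>x. prod (f x) (g x))"
proof -
  obtain L where L: "0 \<le> L" "\<And>x y. x \<in> C \<Longrightarrow> y \<in> C \<Longrightarrow> dist (f x) (f y) \<le> L * dist x y"
    by (rule lipschitzian_onE[OF f]) (rule that)
  obtain M where M: "0 \<le> M" "\<And>x y. x \<in> C \<Longrightarrow> y \<in> C \<Longrightarrow> dist (g x) (g y) \<le> M * dist x y"
    by (rule lipschitzian_onE[OF g]) (rule that)
  obtain A where A: "0 < A" "\<And>x. x \<in> C \<Longrightarrow> norm (f x) \<le> A"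
    by (rule lipschitzian_on_norm_bound[OF f C]) (rule that)
  obtain B where B: "0 < B" "\<And>x. x \<in> C \<Longrightarrow> norm (g x) \<le> B"
    by (rule lipschitzian_on_norm_bound[OF g C]) (rule that)
  obtain K where K: "0 < K" "\<And>a b. norm (prod a b) \<le> norm a * norm b * K"
    using bounded_bilinear.pos_bounded[OF prod] by blast
  show ?thesis
  proof (rule lipschitzian_onI)
    fix x y assume xy: "x \<in> C" "y \<in> C"
    have "prod (f x) (g x) - prod (f y) (g y) = prod (f x) (g x - g y) + prod (f x - f y) (g y)"
      by (simp add: bounded_bilinear.diff_left[OF prod] bounded_bilinear.diff_right[OF prod])
    then have "dist (prod (f x) (g x)) (prod (f y) (g y))
        \<le> norm (prod (f x) (g x - g y)) + norm (prod (f x - f y) (g y))"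
      by (simp add: dist_norm norm_triangle_ineq)
    also have "\<dots> \<le> norm (f x) * dist (g x) (g y) * K + dist (f x) (f y) * norm (g y) * K"
      unfolding dist_norm by (intro add_mono K)
    also have "\<dots> \<le> A * (M * dist x y) * K + (L * dist x y) * B * K"
      using A B L M K xy by (intro add_mono mult_mono) auto
    finally show "dist (prod (f x) (g x)) (prod (f y) (g y)) \<le> (A * M * K + L * B * K) * dist x y"
      by (simp add: algebra_simps)
  qed
qed

lemmas lipschitzian_on_scaleR = lipschitzian_on_bilinear[OF bounded_bilinear_scaleR]
lemmas lipschitzian_on_mult = lipschitzian_on_bilinear[OF bounded_bilinear_mult]

text \<open>The mean value inequality on a convex set \<open>S\<close> that contains the values of
  \<open>f\<close>.\<close>

lemma lipschitzian_on_differentiable: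
  fixes g g' :: "real \<Rightarrow> real"
  assumes f: "lipschitzian_on C f" "f ` C \<subseteq> S" and S: "convex S"
    and deriv: "\<And>y. y \<in> S \<Longrightarrow> (g has_real_derivative g' y) (at y)" "\<And>y. y \<in> S \<Longrightarrow> \<bar>g' y\<bar> \<le> B"
  shows "lipschitzian_on C (\<lambda>x. g (f x))"
proof (rule lipschitzian_on_compose[OF f(1) _ f(2)], rule lipschitzian_onI)
  fix x y assume "x \<in> S" "y \<in> S"
  have "norm (g x - g y) \<le> B * norm (x - y)"
    by (rule field_differentiable_bound[OF S _ _ \<open>x \<in> S\<close> \<open>y \<in> S\<close>])
      (use deriv in \<open>auto intro: has_field_derivative_at_within\<close>)
  then show "dist (g x) (g y) \<le> B * dist x y"
    by (simp add: dist_norm)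
qed

lemma lipschitzian_on_exp:
  fixes f :: "'a::metric_space \<Rightarrow> real"
  assumes f: "lipschitzian_on C f" and C: "compact C"
  shows "lipschitzian_on C (\<lambda>x. exp (f x))"
proof -
  obtain B where B: "\<And>x. x \<in> C \<Longrightarrow> norm (f x) \<le> B"
    using lipschitzian_on_norm_bound[OF f C] by blast
  show ?thesis
  proof (rule lipschitzian_on_differentiable[OF f, of "{..B}" exp exp "exp B"])
    show "f ` C \<subseteq> {..B}"
      using B by (force simp: abs_le_iff)
  qed (auto intro!: derivative_eq_intros)
qed

text \<open>Keeps the argument of \<open>inverse\<close> and \<open>ln\<close> away from
  \<open>0\<close>, where their derivatives blow up.\<close>

lemma positive_lower_bound:
  fixes f :: "'a::metric_space \<Rightarrow> real"
  assumes f: "lipschitzian_on C f" and C: "compact C" and pos: "\<And>x. x \<in> C \<Longrightarrow> 0 < f x"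
  obtains c where "0 < c" "\<And>x. x \<in> C \<Longrightarrow> c \<le> f x"
proof (cases "C = {}")
  case False
  then obtain x0 where "x0 \<in> C" "\<And>x. x \<in> C \<Longrightarrow> f x0 \<le> f x"
    using continuous_attains_inf[OF C _ lipschitzian_on_continuous[OF f]] by blast
  then show ?thesis
    using that pos by blast
qed (use that[of 1] in auto)

lemma lipschitzian_on_inverse:
  fixes f :: "'a::metric_space \<Rightarrow> real"
  assumes f: "lipschitzian_on C f" and C: "compact C" and pos: "\<And>x. x \<in> C \<Longrightarrow> 0 < f x"
  shows "lipschitzian_on C (\<lambda>x. inverse (f x))"
proof -
  obtain c where c: "0 < c" "\<And>x. x \<in> C \<Longrightarrow> c \<le> f x"
    by (rule positive_lower_bound[OF f C pos]) (assumption, rule that)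
  show ?thesis
  proof (rule lipschitzian_on_differentiable[OF f, of "{c..}" inverse "\<lambda>y. - (inverse y * inverse y)" "inverse c * inverse c"])
    show "(inverse has_real_derivative - (inverse y * inverse y)) (at y)" if "y \<in> {c..}" for y
      using that c(1) by (auto intro!: derivative_eq_intros)
    show "\<bar>- (inverse y * inverse y)\<bar> \<le> inverse c * inverse c" if "y \<in> {c..}" for y
      using that c(1) by (auto simp: abs_mult intro!: mult_mono)
  qed (use c in auto)
qed

lemma lipschitzian_on_ln:
  fixes f :: "'a::metric_space \<Rightarrow> real"
  assumes f: "lipschitzian_on C f" and C: "compact C" and pos: "\<And>x. x \<in> C \<Longrightarrow> 0 < f x"
  shows "lipschitzian_on C (\<lambda>x. ln (f x))"
proof -
  obtain c where c: "0 < c" "\<And>x. x \<in> C \<Longrightarrow> c \<le> f x"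
    by (rule positive_lower_bound[OF f C pos]) (assumption, rule that)
  show ?thesis
  proof (rule lipschitzian_on_differentiable[OF f, of "{c..}" ln "\<lambda>y. inverse y" "inverse c"])
    show "(ln has_real_derivative inverse y) (at y)" if "y \<in> {c..}" for y
      using that c(1) by (auto intro!: derivative_eq_intros simp: divide_inverse)
    show "\<bar>inverse y\<bar> \<le> inverse c" if "y \<in> {c..}" for y
      using that c(1) by auto
  qed (use c in auto)
qed

section \<open>The metric and the phase space\<close>

lemma l1_norm_ge_norm: "norm x \<le> l1_norm x"
  unfolding l1_norm_def by (rule norm_le_l1_cart)

lemma l1_norm_le_norm: "l1_norm (x :: real^'n::finite) \<le> CARD('n) * norm x"
  unfolding l1_norm_def using sum_bounded_above[of UNIV "\<lambda>i. \<bar>x $ i\<bar>" "norm x"] component_le_norm_cart[of x]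
  by simp

lemma dist_le_dX: "dist p q \<le> dX p q"
proof -
  obtain a b c a' b' c' where pq: "p = (a, b, c)" "q = (a', b', c')"
    by (metis prod_cases3)
  have "dist p q \<le> norm (a - a') + norm (b - b', c - c')"
    unfolding dist_norm pq using norm_Pair_le[of "a - a'" "(b - b', c - c')"] by simp
  also have "\<dots> \<le> norm (a - a') + (norm (b - b') + norm (c - c'))"
    by (intro add_left_mono norm_Pair_le)
  also have "\<dots> \<le> dX p q"
    using l1_norm_ge_norm[of "c - c'"] by (simp add: dX_def pq)
  finally show ?thesis .
qed

lemma dX_le_dist: "\<exists>c>0. \<forall>p q. dX p q \<le> c * dist p q"
proof (intro exI conjI allI)
  fix p q :: "(real^'a) \<times> (real^'b) \<times> (real^'c)"
  obtain a b c a' b' c' where pq: "p = (a, b, c)" "q = (a', b', c')"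
    by (metis prod_cases3)
  have "norm (a - a') \<le> dist p q" "norm (b - b') \<le> dist p q" "norm (c - c') \<le> dist p q"
    using dist_fst_le[of p q] dist_fst_le[of "snd p" "snd q"] dist_snd_le[of "snd p" "snd q"] dist_snd_le[of p q]
    by (auto simp: pq dist_norm)
  moreover have "l1_norm (c - c') \<le> CARD('c) * norm (c - c')"
    by (rule l1_norm_le_norm)
  moreover have "CARD('c) * norm (c - c') \<le> CARD('c) * dist p q"
    using calculation by (intro mult_left_mono) auto
  moreover have "dX p q = norm (a - a') + norm (b - b') + l1_norm (c - c')"
    by (simp add: dX_def pq)
  ultimately show "dX p q \<le> (2 + real CARD('c)) * dist p q"
    unfolding distrib_right by linarith
qed auto

text \<open>The two-sided comparison of \<open>dX\<close> with \<open>dist\<close> nests the balls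
  of either metric in those of the other, so topological claims about \<open>dX\<close> can be
  settled in the Euclidean topology.\<close>

lemma mtopology_dX:
  fixes X :: "((real^'d::finite) \<times> (real^'m::finite) \<times> (real^'n::finite)) set"
  shows "Metric_space.mtopology X dX = top_of_set X"
proof -
  interpret Metric_space X dX
    by (rule Metric_space_dX)
  obtain c where c: "0 < c"
    "\<And>p q :: (real^'d) \<times> (real^'m) \<times> (real^'n). dX p q \<le> c * dist p q"
    using dX_le_dist by metis
  have "(\<exists>e>0. mball x e \<subseteq> U) \<longleftrightarrow> (\<exists>e>0. ball x e \<inter> X \<subseteq> U)" if x: "x \<in> X" for x U
  proof
    assume "\<exists>e>0. mball x e \<subseteq> U"
    then obtain e where e: "0 < e" "mball x e \<subseteq> U" by auto
    have "ball x (e / c) \<inter> X \<subseteq> mball x e"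
    proof
      fix y assume y: "y \<in> ball x (e / c) \<inter> X"
      then have "c * dist x y < e"
        using c(1) by (simp add: field_simps)
      then show "y \<in> mball x e"
        using c(2)[of x y] x y by auto
    qed
    then show "\<exists>e>0. ball x e \<inter> X \<subseteq> U"
      using e c(1) by (intro exI[of _ "e / c"]) auto
  next
    assume "\<exists>e>0. ball x e \<inter> X \<subseteq> U"
    then obtain e where e: "0 < e" "ball x e \<inter> X \<subseteq> U" by auto
    have "mball x e \<subseteq> ball x e \<inter> X"
      by (auto intro: le_less_trans[OF dist_le_dX])
    then show "\<exists>e>0. mball x e \<subseteq> U"
      using e by blast
  qed
  then have "openin mtopology U \<longleftrightarrow> openin (top_of_set X) U" for U
    unfolding openin_mtopology openin_contains_ball by blast
  then show ?thesis
    by (simp add: topology_eq)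
qed

lemma mbounded_dX_imp_bounded:
  assumes "Metric_space.mbounded X dX B"
  shows "B \<subseteq> X" "bounded B"
proof -
  interpret Metric_space X dX
    by (rule Metric_space_dX)
  obtain x b where xb: "B \<subseteq> mcball x b"
    using assms unfolding mbounded_def by auto
  then show "B \<subseteq> X"
    by auto
  have "B \<subseteq> cball x b"
  proof
    fix y assume "y \<in> B"
    then have "dX x y \<le> b"
      using xb by auto
    then show "y \<in> cball x b"
      using dist_le_dX[of x y] by simp
  qed
  then show "bounded B"
    by (rule bounded_subset[OF bounded_cball])
qed

lemma Theta_eq_cbox: "Theta R = cbox (\<chi> j. - R) (\<chi> j. R)"
  by (auto simp: Theta_def mem_box_cart)

lemma prob_simplex_convex: "convex prob_simplex"
proof (rule convexI)
  fix x y :: "real^'n" and u v :: real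
  assume xy: "x \<in> prob_simplex" "y \<in> prob_simplex" and uv: "0 \<le> u" "0 \<le> v" "u + v = 1"
  have "(\<Sum>i\<in>UNIV. (u *\<^sub>R x + v *\<^sub>R y) $ i) = u * (\<Sum>i\<in>UNIV. x $ i) + v * (\<Sum>i\<in>UNIV. y $ i)"
    by (simp add: sum.distrib sum_distrib_left)
  then show "u *\<^sub>R x + v *\<^sub>R y \<in> prob_simplex"
    using xy uv by (auto simp: prob_simplex_def)
qed

lemma prob_simplex_compact: "compact (prob_simplex :: (real^'n::finite) set)"
proof -
  have "closed (prob_simplex :: (real^'n) set)"
    unfolding prob_simplex_def
    by (intro closed_Collect_conj closed_Collect_all closed_Collect_le closed_Collect_eq continuous_intros)
  moreover have "norm x \<le> 1" if "x \<in> prob_simplex" for x :: "real^'n"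
    using that norm_le_l1_cart[of x] by (simp add: prob_simplex_def)
  then have "bounded (prob_simplex :: (real^'n) set)"
    unfolding bounded_iff by blast
  ultimately show ?thesis
    by (simp add: compact_eq_bounded_closed)
qed

section \<open>The vector field\<close>

lemma policy_denominator_pos: "0 < (\<Sum>b\<in>(UNIV::'k::finite set). exp (f b :: real))"
  by (intro sum_pos) auto

lemma policy_pos: "0 < policy psi tau theta i a"
  unfolding policy_def by (intro divide_pos_pos policy_denominator_pos) auto

lemma policy_sum: "(\<Sum>a\<in>UNIV. policy psi tau theta i a) = 1"
  unfolding policy_def sum_divide_distrib[symmetric]
  using policy_denominator_pos[of "\<lambda>b. (psi i b \<bullet> theta) / tau"] by simp

lemma ln_policy:
  "ln (policy psi tau theta i a) = (psi i a \<bullet> theta) / tau - ln (\<Sum>b\<in>UNIV. exp ((psi i b \<bullet> theta) / tau))"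
  unfolding policy_def using policy_denominator_pos[of "\<lambda>b. (psi i b \<bullet> theta) / tau"]
  by (subst ln_div) auto

text \<open>The derivative is unique as a linear functional, and a vector is determined by its inner
  products; this discharges the definite description in \<open>gradient\<close>.\<close>

lemma gradient_eq:
  assumes D: "GDERIV f x :> D"
  shows "gradient f x = D"
  unfolding gradient_def
proof (rule the_equality)
  show "GDERIV f x :> D"
    by (rule D)
  fix D' assume "GDERIV f x :> D'"
  then have "(\<lambda>h. h \<bullet> D') = (\<lambda>h. h \<bullet> D)"
    using D unfolding gderiv_def by (rule has_derivative_unique)
  then show "D' = D"
    unfolding fun_eq_iff vector_eq_ldot .
qed

text \<open>The score function of the softmax policy: the feature minus its mean under the policy.
  In this closed form Lipschitz continuity of the gradient follows from that of
  \<open>policy\<close>.\<close>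

lemma gradient_ln_policy:
  "gradient (\<lambda>theta. ln (policy psi tau theta i a)) theta
    = (1 / tau) *\<^sub>R (psi i a - (\<Sum>b\<in>UNIV. policy psi tau theta i b *\<^sub>R psi i b))"
proof (rule gradient_eq)
  have Z: "(\<Sum>b\<in>UNIV. exp ((psi i b \<bullet> theta) / tau)) > 0"
    by (rule policy_denominator_pos)
  have "((\<lambda>theta. ln (policy psi tau theta i a)) has_derivative
      (\<lambda>h. (psi i a \<bullet> h) / tau
        - (\<Sum>b\<in>UNIV. exp ((psi i b \<bullet> theta) / tau) * ((psi i b \<bullet> h) / tau))
            / (\<Sum>b\<in>UNIV. exp ((psi i b \<bullet> theta) / tau)))) (at theta)"
    unfolding ln_policy using Z
    by (auto intro!: derivative_eq_intros simp: divide_inverse ac_simps)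
  also have "(\<lambda>h. (psi i a \<bullet> h) / tau
        - (\<Sum>b\<in>UNIV. exp ((psi i b \<bullet> theta) / tau) * ((psi i b \<bullet> h) / tau))
            / (\<Sum>b\<in>UNIV. exp ((psi i b \<bullet> theta) / tau)))
      = (\<lambda>h. h \<bullet> ((1 / tau) *\<^sub>R (psi i a - (\<Sum>b\<in>UNIV. policy psi tau theta i b *\<^sub>R psi i b))))"
    by (simp add: fun_eq_iff policy_def inner_diff_right inner_sum_right sum_divide_distrib
        inner_commute diff_divide_distrib mult.commute[of tau])
  finally show "GDERIV (\<lambda>theta. ln (policy psi tau theta i a)) theta :>
      (1 / tau) *\<^sub>R (psi i a - (\<Sum>b\<in>UNIV. policy psi tau theta i b *\<^sub>R psi i b))"
    by (simp add: gderiv_def)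
qed

lemma D_mat_mult: "(D_mat R theta *v v) $ j = (R\<^sup>2 - (theta $ j)\<^sup>2) * v $ j"
  by (simp add: D_mat_def matrix_vector_mult_def if_distrib[of "\<lambda>x. x * _"] sum.delta cong: if_cong)

lemma outer_mult: "outer v *v w = (v \<bullet> w) *\<^sub>R v"
  by (simp add: vec_eq_iff outer_def matrix_vector_mult_def inner_vec_def sum_distrib_left ac_simps)

lemma A_mat_mult:
  fixes w :: "real^'m::finite"
  shows "A_mat psi phi tau lam theta mu *v w
    = lam *\<^sub>R w + (\<Sum>i\<in>UNIV. \<Sum>a\<in>UNIV. (nu psi tau theta mu i a * (phi i a \<bullet> w)) *\<^sub>R phi i a)"
proof -
  have sum_mult: "sum M I *v w = (\<Sum>i\<in>I. M i *v w)" for M :: "'i \<Rightarrow> real^'m^'m" and I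
    by (induction I rule: infinite_finite_induct) (auto simp: matrix_vector_mult_add_rdistrib)
  show ?thesis
    by (simp add: A_mat_def matrix_vector_mult_add_rdistrib scaleR_matrix_vector_assoc[symmetric] sum_mult
        outer_mult)
qed

text \<open>The unit vector \<open>axis j 1\<close> has \<open>l1\<close> norm one and is mapped to
  column \<open>j\<close>. Before it can be tested against the supremum, the quotients must be
  bounded above, here by the sum of all absolute entries.\<close>

lemma l1_onorm_entry: "\<bar>M $ i $ j\<bar> \<le> l1_onorm M"
proof -
  have "l1_norm (M *v x) / l1_norm x \<le> (\<Sum>i\<in>UNIV. \<Sum>j\<in>UNIV. \<bar>M $ i $ j\<bar>)" for x
  proof -
    have x: "\<bar>x $ j\<bar> \<le> l1_norm x" "0 \<le> l1_norm x" for j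
      unfolding l1_norm_def by (auto intro!: member_le_sum sum_nonneg)
    have "l1_norm (M *v x) \<le> (\<Sum>i\<in>UNIV. \<Sum>j\<in>UNIV. \<bar>M $ i $ j\<bar> * \<bar>x $ j\<bar>)"
      unfolding l1_norm_def matrix_vector_mult_def
      by (auto intro!: sum_mono order_trans[OF sum_abs] simp: abs_mult)
    also have "\<dots> \<le> (\<Sum>i\<in>UNIV. \<Sum>j\<in>UNIV. \<bar>M $ i $ j\<bar> * l1_norm x)"
      by (intro sum_mono mult_left_mono x) auto
    also have "\<dots> = (\<Sum>i\<in>UNIV. \<Sum>j\<in>UNIV. \<bar>M $ i $ j\<bar>) * l1_norm x"
      by (simp add: sum_distrib_right)
    finally show ?thesis
      using x(2) by (cases "l1_norm x = 0") (auto simp: divide_le_eq intro!: sum_nonneg)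
  qed
  then have "bdd_above (range (\<lambda>x. l1_norm (M *v x) / l1_norm x))"
    by (auto simp: bdd_above_def)
  then have "l1_norm (M *v axis j 1) / l1_norm (axis j 1) \<le> l1_onorm M"
    unfolding l1_onorm_def by (rule cSUP_upper[OF UNIV_I])
  moreover have "l1_norm (axis j 1 :: real^'a) = 1"
    by (simp add: l1_norm_def axis_def if_distrib[of abs] cong: if_cong)
  moreover have "\<bar>M $ i $ j\<bar> \<le> l1_norm (M *v axis j 1)"
    unfolding l1_norm_def matrix_vector_mult_basis column_def
    by (rule order_trans[OF _ member_le_sum[of i]]) auto
  ultimately show ?thesis
    by simp
qed

section \<open>The actor-critic system and its slabs\<close>

locale actor_critic =
  fixes r :: "'n::finite \<Rightarrow> 'k::finite \<Rightarrow> real"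
    and psi :: "'n \<Rightarrow> 'k \<Rightarrow> real^'d::finite"
    and phi :: "'n \<Rightarrow> 'k \<Rightarrow> real^'m::finite"
    and Q :: "real^'d \<Rightarrow> real^'n^'n"
    and R tau lam delta :: real
  assumes R_pos: "0 < R" and lam_pos: "0 < lam" and delta_pos: "0 < delta"
    and generator: "\<And>theta. theta \<in> Theta R \<Longrightarrow> generator_matrix (Q theta)"
    and lipschitz: "\<exists>L_Q>0. \<forall>theta\<in>Theta R. \<forall>theta'\<in>Theta R.
      l1_onorm (transpose (Q theta) - transpose (Q theta')) \<le> L_Q * norm (theta - theta')"
begin

abbreviation field :: "(real^'d) \<times> (real^'m) \<times> (real^'n) \<Rightarrow> (real^'d) \<times> (real^'m) \<times> (real^'n)" where
  "field \<equiv> vector_field r psi phi R tau lam Q delta"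

abbreviation states :: "((real^'d) \<times> (real^'m) \<times> (real^'n)) set" where
  "states \<equiv> phase_space R"

abbreviation slab :: "real \<Rightarrow> ((real^'d) \<times> (real^'m) \<times> (real^'n)) set" where
  "slab rho \<equiv> Theta R \<times> cball 0 rho \<times> prob_simplex"

lemma slab_subset: "slab rho \<subseteq> states"
  by (auto simp: phase_space_def)

lemma compact_slab: "compact (slab rho)"
  by (intro compact_Times compact_cball prob_simplex_compact) (simp add: Theta_eq_cbox)

lemma convex_slab: "convex (slab rho)"
  by (intro convex_Times convex_cball prob_simplex_convex) (simp add: Theta_eq_cbox convex_box)

section \<open>Lipschitz continuity of the vector field on compact sets\<close>

context
  fixes C :: "((real^'d) \<times> (real^'m) \<times> (real^'n)) set"
  assumes C: "compact C" "\<And>p. p \<in> C \<Longrightarrow> fst p \<in> Theta R"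
begin

lemma lipschitzian_on_mu: "lipschitzian_on C (\<lambda>p. snd (snd p) $ i)"
  by (rule lipschitzian_on_linear[OF bounded_linear_vec_nth lipschitzian_on_snd_snd])

lemma lipschitzian_on_score: "lipschitzian_on C (\<lambda>p. (psi i a \<bullet> fst p) / tau)"
  by (rule lipschitzian_on_linear[OF bounded_linear_divide
        lipschitzian_on_linear[OF bounded_linear_inner_right lipschitzian_on_fst]])

lemma lipschitzian_on_partition: "lipschitzian_on C (\<lambda>p. \<Sum>b\<in>UNIV. exp ((psi i b \<bullet> fst p) / tau))"
  by (intro lipschitzian_on_sum lipschitzian_on_exp lipschitzian_on_score C)

lemma lipschitzian_on_policy: "lipschitzian_on C (\<lambda>p. policy psi tau (fst p) i a)"
  unfolding policy_def divide_inverse[of "exp _"]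
  by (intro lipschitzian_on_mult lipschitzian_on_exp lipschitzian_on_score lipschitzian_on_inverse
      lipschitzian_on_partition policy_denominator_pos C)

lemma lipschitzian_on_ln_policy: "lipschitzian_on C (\<lambda>p. ln (policy psi tau (fst p) i a))"
  unfolding ln_policy
  by (intro lipschitzian_on_diff lipschitzian_on_score lipschitzian_on_ln lipschitzian_on_partition
      policy_denominator_pos C)

lemma lipschitzian_on_nu: "lipschitzian_on C (\<lambda>p. nu psi tau (fst p) (snd (snd p)) i a)"
  unfolding nu_def by (intro lipschitzian_on_mult lipschitzian_on_mu lipschitzian_on_policy C)

lemma lipschitzian_on_G_tilde:
  "lipschitzian_on C (\<lambda>p. G_tilde r psi phi tau (fst p) (fst (snd p)) (snd (snd p)))"
  unfolding G_tilde_def gradient_ln_policy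
  by (intro lipschitzian_on_sum lipschitzian_on_scaleR lipschitzian_on_mult lipschitzian_on_nu
      lipschitzian_on_add lipschitzian_on_diff lipschitzian_on_const lipschitzian_on_ln_policy
      lipschitzian_on_policy C lipschitzian_on_linear[OF bounded_linear_inner_right lipschitzian_on_fst_snd])

lemma lipschitzian_on_Q: "lipschitzian_on C (\<lambda>p. Q (fst p) $ i $ j)"
proof -
  obtain L where L: "0 < L" "\<And>theta theta'. theta \<in> Theta R \<Longrightarrow> theta' \<in> Theta R \<Longrightarrow>
      l1_onorm (transpose (Q theta) - transpose (Q theta')) \<le> L * norm (theta - theta')"
    using lipschitz by blast
  show ?thesis
  proof (rule lipschitzian_onI)
    fix p q assume pq: "p \<in> C" "q \<in> C"
    have "\<bar>Q (fst p) $ i $ j - Q (fst q) $ i $ j\<bar> \<le> l1_onorm (transpose (Q (fst p)) - transpose (Q (fst q)))"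
      using l1_onorm_entry[of "transpose (Q (fst p)) - transpose (Q (fst q))" j i] by (simp add: transpose_def)
    also have "\<dots> \<le> L * dist (fst p) (fst q)"
      unfolding dist_norm by (intro L C pq)
    also have "\<dots> \<le> L * dist p q"
      using L(1) by (intro mult_left_mono dist_fst_le) auto
    finally show "dist (Q (fst p) $ i $ j) (Q (fst q) $ i $ j) \<le> L * dist p q"
      by (simp add: dist_real_def)
  qed
qed

lemma lipschitzian_on_field: "lipschitzian_on C field"
proof -
  have actor: "lipschitzian_on C (\<lambda>p. G_vec r psi phi R tau (fst p) (fst (snd p)) (snd (snd p)))"
    unfolding G_vec_def
    by (rule lipschitzian_on_vec, unfold D_mat_mult power2_eq_square)
      (intro lipschitzian_on_mult lipschitzian_on_diff lipschitzian_on_const C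
        lipschitzian_on_linear[OF bounded_linear_vec_nth lipschitzian_on_fst]
        lipschitzian_on_linear[OF bounded_linear_vec_nth lipschitzian_on_G_tilde])
  have critic: "lipschitzian_on C (\<lambda>p. b_vec r psi phi tau (fst p) (snd (snd p))
      - A_mat psi phi tau lam (fst p) (snd (snd p)) *v fst (snd p))"
    unfolding b_vec_def A_mat_mult
    by (intro lipschitzian_on_diff lipschitzian_on_add lipschitzian_on_sum lipschitzian_on_scaleR
        lipschitzian_on_mult lipschitzian_on_nu lipschitzian_on_const C lipschitzian_on_fst_snd
        lipschitzian_on_linear[OF bounded_linear_inner_right lipschitzian_on_fst_snd])
  have measure: "lipschitzian_on C (\<lambda>p. (1 / delta) *\<^sub>R (transpose (Q (fst p)) *v snd (snd p)))"
  proof (rule lipschitzian_on_linear[OF bounded_linear_scaleR_right lipschitzian_on_vec])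
    fix i
    show "lipschitzian_on C (\<lambda>p. (transpose (Q (fst p)) *v snd (snd p)) $ i)"
      unfolding matrix_vector_mult_def transpose_def vec_lambda_beta
      by (intro lipschitzian_on_sum lipschitzian_on_mult lipschitzian_on_Q lipschitzian_on_mu C)
  qed
  show ?thesis
    using lipschitzian_on_Pair[OF actor lipschitzian_on_Pair[OF critic measure]]
    by (simp add: vector_field_def case_prod_beta')
qed

end

section \<open>Dissipation estimate for the critic\<close>

lemma nu_nonneg: "mu \<in> prob_simplex \<Longrightarrow> 0 \<le> nu psi tau theta mu i a"
  using policy_pos[of psi tau theta i a] by (simp add: nu_def prob_simplex_def less_imp_le)

lemma nu_sum: "mu \<in> prob_simplex \<Longrightarrow> (\<Sum>i\<in>UNIV. \<Sum>a\<in>UNIV. nu psi tau theta mu i a) = 1"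
  by (simp add: nu_def sum_distrib_left[symmetric] policy_sum prob_simplex_def)

lemma abs_r_le: "\<bar>r i a\<bar> \<le> M_r r"
proof -
  have "(\<lambda>(i, a). \<bar>r i a\<bar>) (i, a) \<le> M_r r"
    unfolding M_r_def by (intro Max_ge finite_imageI finite rangeI)
  then show ?thesis
    by simp
qed

lemma norm_phi_le: "norm (phi i a) \<le> M_phi phi"
proof -
  have "(\<lambda>(i, a). norm (phi i a)) (i, a) \<le> M_phi phi"
    unfolding M_phi_def by (intro Max_ge finite_imageI finite rangeI)
  then show ?thesis
    by simp
qed

lemma M_r_nonneg: "0 \<le> M_r r"
  by (rule order_trans[OF abs_ge_zero abs_r_le])

lemma M_phi_nonneg: "0 \<le> M_phi phi"
  by (rule order_trans[OF norm_ge_zero norm_phi_le])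

lemma B_b_nonneg: "0 \<le> B_b r phi"
  using M_r_nonneg M_phi_nonneg by (simp add: B_b_def)

text \<open>\<open>b_vec\<close> is an average, with probability weights \<open>nu\<close>, of
  vectors of norm at most \<open>B_b\<close>.\<close>

lemma norm_b_vec_le:
  assumes mu: "mu \<in> prob_simplex"
  shows "norm (b_vec r psi phi tau theta mu) \<le> B_b r phi"
proof -
  have "norm (b_vec r psi phi tau theta mu) \<le> (\<Sum>i\<in>UNIV. \<Sum>a\<in>UNIV. nu psi tau theta mu i a * B_b r phi)"
    unfolding b_vec_def
  proof (intro order_trans[OF norm_sum] sum_mono)
    fix i a
    have "norm ((nu psi tau theta mu i a * r i a) *\<^sub>R phi i a)
        = nu psi tau theta mu i a * (\<bar>r i a\<bar> * norm (phi i a))"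
      using nu_nonneg[OF mu] by (simp add: abs_mult)
    also have "\<dots> \<le> nu psi tau theta mu i a * B_b r phi"
      unfolding B_b_def
      by (intro mult_left_mono mult_mono abs_r_le norm_phi_le nu_nonneg[OF mu] M_r_nonneg) auto
    finally show "norm ((nu psi tau theta mu i a * r i a) *\<^sub>R phi i a) \<le> nu psi tau theta mu i a * B_b r phi" .
  qed
  also have "\<dots> = B_b r phi"
    by (simp add: sum_distrib_right[symmetric] nu_sum[OF mu])
  finally show ?thesis .
qed

text \<open>The rank-one terms of \<open>A_mat\<close> contribute nonnegative squares, so its
  quadratic form is at least \<open>lam * (norm w)\<^sup>2\<close>. Half of this, after doubling,
  absorbs the forcing term by completing the square of \<open>norm w - B_b / lam\<close>.\<close>

lemma inner_critic_le:
  assumes mu: "mu \<in> prob_simplex"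
  shows "2 * (w \<bullet> (b_vec r psi phi tau theta mu - A_mat psi phi tau lam theta mu *v w))
    \<le> - lam * ((norm w)\<^sup>2 - (B_b r phi / lam)\<^sup>2)"
proof -
  have "0 \<le> (\<Sum>i\<in>UNIV. \<Sum>a\<in>UNIV. nu psi tau theta mu i a * (phi i a \<bullet> w)\<^sup>2)"
    by (intro sum_nonneg mult_nonneg_nonneg nu_nonneg[OF mu]) auto
  also have "lam * (norm w)\<^sup>2 + \<dots> = w \<bullet> (A_mat psi phi tau lam theta mu *v w)"
    by (simp add: A_mat_mult inner_add_right inner_sum_right power2_norm_eq_inner
        power2_eq_square[of "w \<bullet> phi _ _"] inner_commute[of "phi _ _" w] mult.assoc)
  finally have A: "lam * (norm w)\<^sup>2 \<le> w \<bullet> (A_mat psi phi tau lam theta mu *v w)"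
    by simp
  have "w \<bullet> b_vec r psi phi tau theta mu \<le> norm w * B_b r phi"
    by (rule order_trans[OF norm_cauchy_schwarz mult_left_mono[OF norm_b_vec_le[OF mu]]]) simp
  moreover have "2 * (norm w * B_b r phi) \<le> lam * (norm w)\<^sup>2 + lam * (B_b r phi / lam)\<^sup>2"
  proof -
    have "0 \<le> lam * (norm w - B_b r phi / lam)\<^sup>2"
      using lam_pos by simp
    also have "\<dots> = lam * (norm w)\<^sup>2 + lam * (B_b r phi / lam)\<^sup>2 - 2 * (norm w * B_b r phi)"
      using lam_pos by (simp add: power2_diff right_diff_distrib distrib_left)
    finally show ?thesis
      by simp
  qed
  ultimately show ?thesis
    using A by (simp add: inner_diff_right right_diff_distrib)
qed

text \<open>A maximum dominates the mean of its arguments, here \<open>1 / 2 + B_b / lam\<close>;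
  squaring drops a nonnegative cross term. The slack \<open>1 / 4\<close> pays for the second-order
  term of an Euler step and lets trajectories reach \<open>K\<close> in finite time.\<close>

lemma R_w_sq_ge: "(B_b r phi / lam)\<^sup>2 + 1 / 4 \<le> (R_w r phi lam)\<^sup>2"
proof -
  have "1 / 2 + B_b r phi / lam \<le> R_w r phi lam"
    unfolding R_w_def by (simp add: max_def)
  moreover have "0 \<le> B_b r phi / lam"
    using B_b_nonneg lam_pos by simp
  ultimately have "(1 / 2 + B_b r phi / lam)\<^sup>2 \<le> (R_w r phi lam)\<^sup>2"
    by (intro power_mono) auto
  then show ?thesis
    using \<open>0 \<le> B_b r phi / lam\<close> by (simp add: power2_sum power_divide)
qed

lemma R_w_ge_1: "1 \<le> R_w r phi lam"
  by (simp add: R_w_def)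

lemma field_components:
  assumes "fst p \<in> Theta R" "snd (snd p) \<in> prob_simplex"
  shows "fst (field p) $ j = (R\<^sup>2 - (fst p $ j)\<^sup>2) * G_tilde r psi phi tau (fst p) (fst (snd p)) (snd (snd p)) $ j"
    and "2 * (fst (snd p) \<bullet> fst (snd (field p))) \<le> - lam * ((norm (fst (snd p)))\<^sup>2 - (B_b r phi / lam)\<^sup>2)"
    and "snd (snd (field p)) $ i = (\<Sum>l\<in>UNIV. Q (fst p) $ l $ i * snd (snd p) $ l) / delta"
proof -
  show "fst (field p) $ j = (R\<^sup>2 - (fst p $ j)\<^sup>2) * G_tilde r psi phi tau (fst p) (fst (snd p)) (snd (snd p)) $ j"
    by (simp add: vector_field_def case_prod_beta' G_vec_def D_mat_mult)
  show "2 * (fst (snd p) \<bullet> fst (snd (field p))) \<le> - lam * ((norm (fst (snd p)))\<^sup>2 - (B_b r phi / lam)\<^sup>2)"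
    using inner_critic_le[OF assms(2)] by (simp add: vector_field_def case_prod_beta')
  show "snd (snd (field p)) $ i = (\<Sum>l\<in>UNIV. Q (fst p) $ l $ i * snd (snd p) $ l) / delta"
    by (simp add: vector_field_def case_prod_beta' matrix_vector_mult_def transpose_def)
qed

end

section \<open>Euler steps that stay in a slab\<close>

lemma generator_matrix_row_sum:
  assumes "generator_matrix M"
  shows "(\<Sum>j\<in>UNIV. M $ i $ j) = 0"
  using assms by (simp add: generator_matrix_def sum.remove[of UNIV i])

text \<open>After the step, the distance to the face \<open>R\<close> factors as
  \<open>(R - x) * (1 - h * (R + x) * g)\<close>, whose second factor is nonnegative for small
  \<open>h\<close>. The opposite face follows by changing the signs of \<open>x\<close> and
  \<open>g\<close>.\<close>

lemma interval_step:
  fixes x g h V R :: real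
  assumes "\<bar>x\<bar> \<le> R" "\<bar>g\<bar> \<le> V" "0 \<le> h" "h * (2 * R * V) \<le> 1"
  shows "\<bar>x + h * ((R\<^sup>2 - x\<^sup>2) * g)\<bar> \<le> R"
proof -
  have *: "0 \<le> (R - y) * (1 - h * (R + y) * k)" if "\<bar>y\<bar> \<le> R" "\<bar>k\<bar> \<le> V" for y k
  proof -
    have "(R + y) * k \<le> (R + y) * V" "(R + y) * V \<le> 2 * R * V"
      using that by (intro mult_left_mono mult_right_mono; linarith)+
    then have "h * ((R + y) * k) \<le> h * (2 * R * V)"
      using assms(3) by (intro mult_left_mono) auto
    then show ?thesis
      using that assms(4) by (intro mult_nonneg_nonneg) (auto simp: mult.assoc)
  qed
  have "0 \<le> R - (x + h * ((R\<^sup>2 - x\<^sup>2) * g))"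
    using *[of x g] assms by (simp add: algebra_simps power2_eq_square)
  moreover have "0 \<le> R + (x + h * ((R\<^sup>2 - x\<^sup>2) * g))"
    using *[of "- x" "- g"] assms by (simp add: algebra_simps power2_eq_square)
  ultimately show ?thesis
    by linarith
qed

text \<open>For small \<open>c\<close> the matrix \<open>I + c M\<close> is stochastic: its rows sum
  to one and its entries are nonnegative. The step is its transpose applied to
  \<open>mu\<close>.\<close>

lemma generator_step:
  fixes M :: "real^'n::finite^'n"
  assumes M: "generator_matrix M" and mu: "mu \<in> prob_simplex" and c: "0 \<le> c" "\<And>i. c * \<bar>M $ i $ i\<bar> \<le> 1"
  shows "(\<chi> i. mu $ i + c * (\<Sum>l\<in>UNIV. M $ l $ i * mu $ l)) \<in> prob_simplex"
proof -
  have mu_nonneg: "0 \<le> mu $ i" for i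
    using mu by (simp add: prob_simplex_def)
  have "0 \<le> mu $ i + c * (\<Sum>l\<in>UNIV. M $ l $ i * mu $ l)" for i
  proof -
    have "0 \<le> (\<Sum>l\<in>UNIV - {i}. M $ l $ i * mu $ l)"
      using M by (intro sum_nonneg mult_nonneg_nonneg mu_nonneg) (auto simp: generator_matrix_def)
    then have "M $ i $ i * mu $ i \<le> (\<Sum>l\<in>UNIV. M $ l $ i * mu $ l)"
      by (simp add: sum.remove[of UNIV i])
    then have "c * (M $ i $ i * mu $ i) \<le> c * (\<Sum>l\<in>UNIV. M $ l $ i * mu $ l)"
      using c(1) by (rule mult_left_mono)
    moreover have "0 \<le> (1 + c * M $ i $ i) * mu $ i"
    proof (rule mult_nonneg_nonneg[OF _ mu_nonneg])
      have "- (c * M $ i $ i) \<le> c * \<bar>M $ i $ i\<bar>"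
        using mult_left_mono[OF _ c(1), of "- M $ i $ i" "\<bar>M $ i $ i\<bar>"] by simp
      then show "0 \<le> 1 + c * M $ i $ i"
        using c(2)[of i] by linarith
    qed
    ultimately show ?thesis
      by (simp add: algebra_simps)
  qed
  moreover have "(\<Sum>i\<in>UNIV. mu $ i + c * (\<Sum>l\<in>UNIV. M $ l $ i * mu $ l)) = 1"
  proof -
    have "(\<Sum>i\<in>UNIV. \<Sum>l\<in>UNIV. M $ l $ i * mu $ l) = (\<Sum>l\<in>UNIV. \<Sum>i\<in>UNIV. M $ l $ i * mu $ l)"
      by (rule sum.swap)
    also have "\<dots> = 0"
      by (simp add: sum_distrib_right[symmetric] generator_matrix_row_sum[OF M])
    finally show ?thesis
      using mu by (simp add: sum.distrib sum_distrib_left[symmetric] prob_simplex_def)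
  qed
  ultimately show ?thesis
    by (simp add: prob_simplex_def)
qed

context actor_critic
begin

text \<open>Expanding the square, the first-order part leaves at most
  \<open>(1 - h * lam) * rho\<^sup>2 + h * lam * (B_b / lam)\<^sup>2\<close>, and the second-order
  part is at most \<open>h * lam / 4\<close>; the slack in \<open>R_w_sq_ge\<close> covers the
  latter.\<close>

lemma critic_step:
  assumes le: "2 * (w \<bullet> v) \<le> - lam * ((norm w)\<^sup>2 - (B_b r phi / lam)\<^sup>2)"
    and rho: "R_w r phi lam \<le> rho" and w: "norm w \<le> rho" and v: "norm v \<le> V"
    and h: "0 \<le> h" "h * lam \<le> 1" "h * V\<^sup>2 \<le> lam / 4"
  shows "norm (w + h *\<^sub>R v) \<le> rho"
proof -
  have rho_nonneg: "0 \<le> rho"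
    using w norm_ge_zero order_trans by blast
  have "(B_b r phi / lam)\<^sup>2 + 1 / 4 \<le> rho\<^sup>2"
    using R_w_sq_ge power_mono[OF rho, of 2] R_w_ge_1 by linarith
  then have "h * lam * (1 / 4) \<le> h * lam * (rho\<^sup>2 - (B_b r phi / lam)\<^sup>2)"
    using h lam_pos by (intro mult_left_mono) auto
  moreover have "h * (h * (norm v)\<^sup>2) \<le> h * (lam / 4)"
    using h(3) power_mono[OF v, of 2] h(1)
    by (intro mult_left_mono order_trans[OF mult_left_mono h(3)]) auto
  moreover have "(1 - h * lam) * (norm w)\<^sup>2 \<le> (1 - h * lam) * rho\<^sup>2"
    using h(2) w by (intro mult_left_mono power_mono) auto
  moreover have "h * (2 * (w \<bullet> v)) \<le> h * (- lam * ((norm w)\<^sup>2 - (B_b r phi / lam)\<^sup>2))"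
    using le h(1) by (rule mult_left_mono)
  moreover have "(norm (w + h *\<^sub>R v))\<^sup>2 = (norm w)\<^sup>2 + h * (2 * (w \<bullet> v)) + h * (h * (norm v)\<^sup>2)"
    unfolding power2_norm_eq_inner
    by (simp add: inner_add_left inner_add_right inner_commute[of v w] distrib_left)
  ultimately have "(norm (w + h *\<^sub>R v))\<^sup>2 \<le> rho\<^sup>2"
    by (simp add: algebra_simps)
  then show ?thesis
    using rho_nonneg by (rule power2_le_imp_le)
qed

lemma step_in_slab:
  assumes rho: "R_w r phi lam \<le> rho"
  obtains h where "0 < h" "\<And>p. p \<in> slab rho \<Longrightarrow> p + h *\<^sub>R field p \<in> slab rho"
proof -
  have Theta: "fst p \<in> Theta R" if "p \<in> slab rho" for p
    using that by auto
  obtain V where V: "0 < V"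
    "\<And>p. p \<in> slab rho \<Longrightarrow> norm (G_tilde r psi phi tau (fst p) (fst (snd p)) (snd (snd p))) \<le> V"
    by (rule lipschitzian_on_norm_bound[OF lipschitzian_on_G_tilde[OF compact_slab Theta] compact_slab])
      (assumption, rule that)
  obtain W where W: "0 < W" "\<And>p. p \<in> slab rho \<Longrightarrow> norm (field p) \<le> W"
    by (rule lipschitzian_on_norm_bound[OF lipschitzian_on_field[OF compact_slab Theta] compact_slab])
      (assumption, rule that)
  \<comment> \<open>The diagonal entries are packed into one vector, so that a single norm bound
    \<open>U\<close> serves for all of them.\<close>
  have "lipschitzian_on (slab rho) (\<lambda>p. \<chi> i. Q (fst p) $ i $ i)"
    by (rule lipschitzian_on_vec) (simp add: lipschitzian_on_Q[OF compact_slab Theta])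
  then obtain U where U: "0 < U" "\<And>p. p \<in> slab rho \<Longrightarrow> norm (\<chi> i. Q (fst p) $ i $ i) \<le> U"
    by (rule lipschitzian_on_norm_bound[OF _ compact_slab]) (rule that)
  \<comment> \<open>One bound each for the actor box, the first-order and the second-order part of
    the critic step, and the diagonal of the generator.\<close>
  define h where "h = Min {1 / (2 * R * V), 1 / lam, (lam / 4) / W\<^sup>2, delta / U}"
  have h_pos: "0 < h"
    using V W U R_pos lam_pos delta_pos by (simp add: h_def)
  have "h \<le> 1 / (2 * R * V)" "h \<le> 1 / lam" "h \<le> (lam / 4) / W\<^sup>2" "h \<le> delta / U"
    by (simp_all add: h_def)
  then have h: "h * (2 * R * V) \<le> 1" "h * lam \<le> 1" "h * W\<^sup>2 \<le> lam / 4" "h / delta * U \<le> 1"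
    using V W U R_pos lam_pos delta_pos by (simp_all add: pos_le_divide_eq)
  show ?thesis
  proof (rule that[OF h_pos])
    fix p assume p: "p \<in> slab rho"
    obtain theta w mu where p_eq: "p = (theta, w, mu)"
      by (rule prod_cases3)
    obtain theta' w' mu' where field_eq: "field p = (theta', w', mu')"
      by (rule prod_cases3)
    have in_sets: "theta \<in> Theta R" "norm w \<le> rho" "mu \<in> prob_simplex"
      using p by (auto simp: p_eq)
    note comps = field_components[of p, unfolded field_eq, unfolded p_eq fst_conv snd_conv, OF in_sets(1,3)]
    have "theta + h *\<^sub>R theta' \<in> Theta R"
    proof -
      have "\<bar>(theta + h *\<^sub>R theta') $ j\<bar> \<le> R" for j
      proof -
        have "\<bar>theta $ j\<bar> \<le> R"
          using in_sets(1) by (auto simp: Theta_def abs_le_iff minus_le_iff)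
        moreover have "\<bar>G_tilde r psi phi tau theta w mu $ j\<bar> \<le> V"
          using component_le_norm_cart V(2)[OF p] by (metis order_trans p_eq fst_conv snd_conv)
        ultimately show ?thesis
          using interval_step[OF _ _ less_imp_le[OF h_pos] h(1)] by (simp add: comps(1))
      qed
      then show ?thesis
        unfolding Theta_def mem_Collect_eq abs_le_iff minus_le_iff[of _ R] by blast
    qed
    moreover have "norm (w + h *\<^sub>R w') \<le> rho"
    proof (rule critic_step[OF comps(2) rho in_sets(2) _ less_imp_le[OF h_pos] h(2,3)])
      have "norm w' \<le> norm (field p)"
        unfolding field_eq by (metis norm_fst_le norm_snd_le order_trans)
      then show "norm w' \<le> W"
        using W(2)[OF p] by linarith
    qed
    moreover have "mu + h *\<^sub>R mu' \<in> prob_simplex"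
    proof -
      have "mu + h *\<^sub>R mu' = (\<chi> i. mu $ i + (h / delta) * (\<Sum>l\<in>UNIV. Q theta $ l $ i * mu $ l))"
        by (simp add: vec_eq_iff comps(3))
      also have "\<dots> \<in> prob_simplex"
      proof (rule generator_step[OF generator[OF in_sets(1)] in_sets(3)])
        show "0 \<le> h / delta"
          using h_pos delta_pos by simp
        fix i
        have "\<bar>Q theta $ i $ i\<bar> \<le> U"
          using component_le_norm_cart[of "\<chi> i. Q theta $ i $ i" i] U(2)[OF p] by (simp add: p_eq)
        then have "h / delta * \<bar>Q theta $ i $ i\<bar> \<le> h / delta * U"
          using h_pos delta_pos by (intro mult_left_mono) auto
        then show "h / delta * \<bar>Q theta $ i $ i\<bar> \<le> 1"
          using h(4) by linarith
      qed
      finally show ?thesis .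
    qed
    ultimately show "p + h *\<^sub>R field p \<in> slab rho"
      by (simp add: p_eq field_eq[unfolded p_eq])
  qed
qed

section \<open>Critic decay, invariant slabs and global solutions\<close>

lemma critic_norm_bound:
  assumes x: "is_solution states field x0 x" and t: "0 \<le> t"
  shows "(norm (fst (snd (x t))))\<^sup>2 - (B_b r phi / lam)\<^sup>2
    \<le> exp (- lam * t) * ((norm (fst (snd x0)))\<^sup>2 - (B_b r phi / lam)\<^sup>2)"
proof -
  define w where "w s = fst (snd (x s))" for s
  have "w t \<bullet> w t - (B_b r phi / lam)\<^sup>2 \<le> exp (- lam * t) * (w 0 \<bullet> w 0 - (B_b r phi / lam)\<^sup>2)"
  \<comment> \<open>The compared quantity is negative once \<open>w\<close> is small, which the
    comparison admits.\<close>
  proof (rule linear_comparison[OF _ _ t])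
    fix s :: real assume s: "0 \<le> s"
    have "(x has_vector_derivative field (x s)) (at s within {0..})"
      using x s by (simp add: is_solution_def)
    then have "(w has_vector_derivative fst (snd (field (x s)))) (at s within {0..})"
      unfolding w_def
      by (intro bounded_linear.has_vector_derivative[OF bounded_linear_fst]
          bounded_linear.has_vector_derivative[OF bounded_linear_snd])
    from bounded_bilinear.has_vector_derivative[OF bounded_bilinear_inner this this]
    have "((\<lambda>s. w s \<bullet> w s) has_real_derivative 2 * (w s \<bullet> fst (snd (field (x s))))) (at s within {0..})"
      by (simp add: has_real_derivative_iff_has_vector_derivative inner_commute)
    from DERIV_diff[OF this DERIV_const]
    show "((\<lambda>s. w s \<bullet> w s - (B_b r phi / lam)\<^sup>2) has_real_derivative
        2 * (w s \<bullet> fst (snd (field (x s))))) (at s within {0..})"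
      by simp
    have "fst (x s) \<in> Theta R" "snd (snd (x s)) \<in> prob_simplex"
      using x s by (auto simp: is_solution_def phase_space_def mem_Times_iff)
    from field_components(2)[OF this]
    show "2 * (w s \<bullet> fst (snd (field (x s)))) \<le> - lam * (w s \<bullet> w s - (B_b r phi / lam)\<^sup>2)"
      by (simp add: w_def power2_norm_eq_inner)
  qed
  then show ?thesis
    using x by (simp add: w_def power2_norm_eq_inner is_solution_def)
qed

text \<open>Concerns every solution with values in \<open>states\<close>, not only those built from
  Euler steps: such a solution can leave the slab only through its critic component, whose excess
  over \<open>(B_b / lam)\<^sup>2\<close> decays.\<close>

lemma slab_invariant:
  assumes rho: "R_w r phi lam \<le> rho" and x: "is_solution states field x0 x" and x0: "x0 \<in> slab rho"
    and t: "0 \<le> t"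
  shows "x t \<in> slab rho"
proof -
  have rho_ge: "0 \<le> rho" "(B_b r phi / lam)\<^sup>2 \<le> rho\<^sup>2"
    using R_w_ge_1 rho R_w_sq_ge power_mono[OF rho, of 2] by linarith+
  have "(norm (fst (snd x0)))\<^sup>2 \<le> rho\<^sup>2"
    using x0 by (intro power_mono) auto
  then have "exp (- lam * t) * ((norm (fst (snd x0)))\<^sup>2 - (B_b r phi / lam)\<^sup>2)
      \<le> exp (- lam * t) * (rho\<^sup>2 - (B_b r phi / lam)\<^sup>2)"
    by (intro mult_left_mono) auto
  also have "\<dots> \<le> 1 * (rho\<^sup>2 - (B_b r phi / lam)\<^sup>2)"
    using rho_ge lam_pos t by (intro mult_right_mono) auto
  finally have "(norm (fst (snd (x t))))\<^sup>2 \<le> rho\<^sup>2"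
    using critic_norm_bound[OF x t] by simp
  then have "norm (fst (snd (x t))) \<le> rho"
    using rho_ge(1) by (rule power2_le_imp_le)
  moreover have "x t \<in> states"
    using x t by (simp add: is_solution_def)
  ultimately show ?thesis
    by (auto simp: phase_space_def mem_Times_iff)
qed

lemma bounded_subset_slab:
  assumes "bounded B" "B \<subseteq> states"
  obtains rho where "R_w r phi lam \<le> rho" "B \<subseteq> slab rho"
proof -
  obtain b where b: "\<And>p. p \<in> B \<Longrightarrow> norm p \<le> b"
    using assms(1) by (auto simp: bounded_iff)
  have "norm (fst (snd p)) \<le> b" if "p \<in> B" for p
    using b[OF that] norm_fst_le[of "snd p"] norm_snd_le[of "snd p" "fst p"]
      norm_fst_le[of "fst (snd p)" "snd (snd p)"] by simp
  then have "B \<subseteq> slab (max b (R_w r phi lam))"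
    using assms(2) by (fastforce simp: phase_space_def)
  then show ?thesis
    by (rule that[rotated]) simp
qed

sublocale lipschitz_invariant_ode states field
proof
  have Theta: "fst p \<in> Theta R" if "p \<in> slab rho" for p rho
    using that by auto
  have lip: "\<exists>L. L-lipschitz_on (slab rho) field" for rho
    using lipschitzian_on_field[OF compact_slab Theta] by (auto simp: lipschitzian_on_def)
  show "\<exists>x. is_solution states field x0 x" if "x0 \<in> states" for x0
  proof -
    have "bounded {x0}" "{x0} \<subseteq> states"
      using that by auto
    then obtain rho where rho: "R_w r phi lam \<le> rho" "{x0} \<subseteq> slab rho"
      by (rule bounded_subset_slab)
    obtain h where h: "0 < h" "\<And>p. p \<in> slab rho \<Longrightarrow> p + h *\<^sub>R field p \<in> slab rho"
      by (rule step_in_slab[OF rho(1)]) (rule that)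
    obtain L where "L-lipschitz_on (slab rho) field"
      using lip by blast
    \<comment> \<open>Existence is obtained within a compact slab around the initial value; the
      values then lie in \<open>states\<close> a fortiori.\<close>
    with rho(2) have "\<exists>x. is_solution (slab rho) field x0 x"
      by (intro invariant_solution_exists[OF convex_slab compact_imp_closed[OF compact_slab] _ h]) auto
    then show ?thesis
      using slab_subset by (auto simp: is_solution_def)
  qed
  show "\<exists>C L. B \<subseteq> C \<and> L-lipschitz_on C field \<and>
      (\<forall>x0\<in>C. \<forall>x. is_solution states field x0 x \<longrightarrow> (\<forall>t\<ge>0. x t \<in> C))"
    if B: "bounded B" "B \<subseteq> states" for B
  proof -
    obtain rho where "R_w r phi lam \<le> rho" "B \<subseteq> slab rho"
      using B by (rule bounded_subset_slab)
    then show ?thesis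
      using lip[of rho] slab_invariant by blast
  qed
qed

section \<open>The absorbing set and the attractor\<close>

abbreviation flow :: "real \<Rightarrow> (real^'d) \<times> (real^'m) \<times> (real^'n) \<Rightarrow> (real^'d) \<times> (real^'m) \<times> (real^'n)" where
  "flow \<equiv> ode_flow states field"

abbreviation K :: "((real^'d) \<times> (real^'m) \<times> (real^'n)) set" where
  "K \<equiv> K_set r phi R lam"

lemma K_eq_slab: "K = slab (R_w r phi lam)"
  by (simp add: K_set_def)

lemma compactin_K: "compactin (Metric_space.mtopology states dX) K"
  unfolding mtopology_dX K_eq_slab using compact_slab slab_subset by (simp add: compactin_subtopology)

lemma K_nonempty: "K \<noteq> {}"
proof -
  have "(0, 0, axis undefined 1) \<in> K"
    using R_pos R_w_ge_1 by (simp add: K_set_def Theta_def prob_simplex_def axis_def)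
  then show ?thesis
    by blast
qed

lemma forward_invariant_K: "forward_invariant flow K"
proof -
  have "flow t x0 \<in> K" if "x0 \<in> K" "0 \<le> t" for x0 t
    using slab_invariant[OF order_refl is_solution_ode_flow] that slab_subset unfolding K_eq_slab by blast
  then show ?thesis
    by (auto simp: forward_invariant_def)
qed

lemma absorbing_K: "absorbing states dX flow K"
  unfolding absorbing_def
proof (intro allI impI)
  fix B assume B: "Metric_space.mbounded states dX B"
  obtain rho where rho: "R_w r phi lam \<le> rho" "B \<subseteq> slab rho"
    by (rule bounded_subset_slab[OF mbounded_dX_imp_bounded(2)[OF B] mbounded_dX_imp_bounded(1)[OF B]])
      (rule that)
  \<comment> \<open>From time \<open>T\<close> on,
    \<open>exp (lam * t) \<ge> lam * t \<ge> 4 * rho\<^sup>2\<close>, so what remains of the initial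
    excess is at most \<open>1 / 4\<close>, the slack in \<open>R_w_sq_ge\<close>.\<close>
  define T where "T = 4 * rho\<^sup>2 / lam"
  show "\<exists>T\<ge>0. \<forall>t\<ge>T. flow t ` B \<subseteq> K"
  proof (intro exI[of _ T] conjI allI impI)
    show T_nonneg: "0 \<le> T"
      using lam_pos by (simp add: T_def)
    fix t assume t: "T \<le> t"
    show "flow t ` B \<subseteq> K"
    proof (rule image_subsetI)
      fix x0 assume x0: "x0 \<in> B"
      let ?w = "fst (snd (flow t x0))"
      have states: "x0 \<in> states"
        using x0 rho(2) slab_subset by blast
      have "4 * rho\<^sup>2 \<le> lam * t"
        using t lam_pos by (simp add: T_def divide_le_eq mult.commute)
      then have "4 * rho\<^sup>2 \<le> exp (lam * t)"
        using exp_ge_add_one_self[of "lam * t"] by linarith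
      then have decay: "exp (- lam * t) * rho\<^sup>2 \<le> 1 / 4"
        by (simp add: exp_minus field_simps)
      have "(norm (fst (snd x0)))\<^sup>2 \<le> rho\<^sup>2"
        using x0 rho(2) by (intro power_mono) auto
      then have "exp (- lam * t) * ((norm (fst (snd x0)))\<^sup>2 - (B_b r phi / lam)\<^sup>2) \<le> exp (- lam * t) * rho\<^sup>2"
        by (intro mult_left_mono order_trans[OF _ \<open>_ \<le> rho\<^sup>2\<close>]) auto
      then have "(norm ?w)\<^sup>2 \<le> (R_w r phi lam)\<^sup>2"
        using critic_norm_bound[OF is_solution_ode_flow[OF states] order_trans[OF T_nonneg t]] decay R_w_sq_ge
        by linarith
      then have "norm ?w \<le> R_w r phi lam"
        by (rule power2_le_imp_le) (use R_w_ge_1 in linarith)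
      then show "flow t x0 \<in> K"
        using ode_flow_in[OF states order_trans[OF T_nonneg t]]
        by (auto simp: K_set_def phase_space_def mem_Times_iff)
    qed
  qed
qed

sublocale dissipative_semiflow states dX flow K
proof (intro dissipative_semiflow.intro dissipative_semiflow_axioms.intro Metric_space_dX)
  show "continuous_map (prod_topology (top_of_set {0..}) (Metric_space.mtopology states dX))
      (Metric_space.mtopology states dX) (\<lambda>(t, x). flow t x)"
    using generates_semiflow[OF mtopology_dX] by (simp add: generates_semiflow_def)
qed (assumption | rule ode_flow_add compactin_K K_nonempty forward_invariant_K absorbing_K)+

end

theorem theorem2:
  fixes r :: "'n::finite \<Rightarrow> 'k::finite \<Rightarrow> real"
    and psi :: "'n \<Rightarrow> 'k \<Rightarrow> real^'d::finite"
    and phi :: "'n \<Rightarrow> 'k \<Rightarrow> real^'m::finite"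
    and Q :: "real^'d \<Rightarrow> real^'n^'n"
    and R_theta tau lam :: real
  assumes "R_theta > 0" and "tau > 0" and "lam > 0"
    and generator: "\<And>theta. theta \<in> Theta R_theta \<Longrightarrow> generator_matrix (Q theta)"
    and lipschitz: "\<exists>L_Q>0. \<forall>theta\<in>Theta R_theta. \<forall>theta'\<in>Theta R_theta.
      l1_onorm (transpose (Q theta) - transpose (Q theta')) \<le> L_Q * norm (theta - theta')"
  shows "\<forall>delta>0.
    let X = (phase_space R_theta :: ((real^'d) \<times> (real^'m) \<times> (real^'n)) set);
        F = vector_field r psi phi R_theta tau lam Q delta;
        S = ode_flow X F;
        K = K_set r phi R_theta lam
    in generates_semiflow X dX F \<and>
       compactin (Metric_space.mtopology X dX) K \<and>
       forward_invariant S K \<and>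
       absorbing X dX S K \<and>
       compact_global_attractor X dX S (omega_limit X dX S K) \<and>
       (\<forall>A. compact_global_attractor X dX S A \<longrightarrow> A = omega_limit X dX S K)"
proof (intro allI impI, goal_cases)
  case (1 delta)
  then interpret actor_critic r psi phi Q R_theta tau lam delta
    using assms by unfold_locales
  show ?case
    unfolding Let_def
    using generates_semiflow[OF mtopology_dX] compactin_K forward_invariant_K absorbing_K
      compact_global_attractor_omega_limit
      compact_global_attractor_unique[OF _ compact_global_attractor_omega_limit]
    by blast
qed

end
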